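(* Let $\{F_t\}_{t\ge0}$ be a two-dimensional (open-set irreducible) Lévy-type process with symbol $q(x,\xi)$, radial in the co-variable $\xi$, and Lévy triplet $(0,c(x)I,\nu(x,dy))$. Assume that there exists $u_0>1$ such that the measure $\nu(x,du\times\mathbb{R})$ is quasi-unimodal with respect to $u_0$ for all $x\in\mathbb{R}^2$. Then $$\int_{B_r(0)}\frac{d\xi}{\sup_{x\in\mathbb{R}^2}|q(x,\xi)|}=\infty\quad\text{for some } r>0$$ if, and only if, $$\int_r^\infty\left(\rho\sup_{x\in\mathbb{R}^2}\int_0^\rho u\,\nu(x,B_u^c(0))\,du\right)^{-1}d\rho=\infty\quad\text{for some (equivalently, all) } r>0.$$ Further, if, in addition, $$\liminf_{|\xi|\to0}\inf_{x\in\mathbb{R}^2}\int_{\mathbb{R}^2}\frac{1-\cos\langle\xi,y\rangle}{|\xi|^2}\,\nu(x,dy)=\infty,$$ then $$\int_{B_r(0)}\frac{d\xi}{\inf_{x\in\mathbb{R}^2}\mathrm{Re}\,q(x,\xi)}<\infty\quad\text{for some } r>0$$ if, and only if, $$\int_r^\infty\left(\rho\inf_{x\in\mathbb{R}^2}\int_0^\rho u\,\nu(x,B_u^c(0))\,du\right)^{-1}d\rho<\infty\quad\text{for some } r>0.$$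
   Context: A Feller process on $\mathbb{R}^d$ is a Markov process $(\{F_t\}_{t\ge0},\{\mathbb{P}^x\}_{x\in\mathbb{R}^d})$ whose semigroup $P_tf(x)=\mathbb{E}^x[f(F_t)]$ is a strongly continuous semigroup on $C_\infty(\mathbb{R}^d)$, the continuous functions vanishing at infinity with the sup norm; its generator on $C_\infty(\mathbb{R}^d)$ is $(\mathcal{A},\mathcal{D}_{\mathcal{A}})$. If $C_c^\infty(\mathbb{R}^d)\subseteq\mathcal{D}_{\mathcal{A}}$, then on $C_c^\infty(\mathbb{R}^d)$ one has $\mathcal{A}f(x)=-\int_{\mathbb{R}^d}q(x,\xi)e^{i\langle\xi,x\rangle}\hat f(\xi)\,d\xi$, with $\hat f(\xi)=(2\pi)^{-d}\int e^{-i\langle\xi,x\rangle}f(x)\,dx$; $q:\mathbb{R}^d\times\mathbb{R}^d\to\mathbb{C}$ is called the symbol. It is measurable and locally bounded, and continuous and negative definite in the co-variable $\xi$. A Lévy-type process is a Feller process with (a) $C_c^\infty(\mathbb{R}^d)\subseteq\mathcal{D}_{\mathcal{A}}$, (b) $\sup_x|q(x,\xi)|\le K(1+|\xi|^2)$ for some finite $K>0$ and all $\xi$, (c) $q(x,0)=0$ for all $x$. Its symbol has the Lévy–Khintchine form $$q(x,\xi)=-i\langle\xi,b(x)\rangle+\tfrac12\langle\xi,C(x)\xi\rangle+\int_{\mathbb{R}^d}\left(1-e^{i\langle\xi,y\rangle}+i\langle\xi,y\rangle1_{B_1(0)}(y)\right)\nu(x,dy),$$ with $b(x)\in\mathbb{R}^d$,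 $C(x)$ symmetric non-negative definite, and $\nu(x,dy)$ a Borel kernel (the Lévy measure) with $\nu(x,\{0\})=0$, $\int\min\{1,|y|^2\}\nu(x,dy)<\infty$; $(b(x),C(x),\nu(x,dy))$ is the Lévy triplet. The process is $\varphi$-irreducible if there is a $\sigma$-finite measure $\varphi$ on $\mathbb{R}^d$ such that $\varphi(B)>0$ implies $\int_0^\infty\mathbb{P}^x(F_t\in B)\,dt>0$ for all $x$; it is open-set irreducible if it has such an irreducibility measure with full support. $B_r(x)$ is the open ball and $B_u^c(0)=\mathbb{R}^2\setminus B_u(0)$. The symbol is radial in the co-variable if $q(x,R\xi)=q(x,\xi)$ for all $x,\xi\in\mathbb{R}^2$ and all rotations $R$ of the plane; then $q$ is real and nonnegative, $b(x)=0$, $C(x)=c(x)I$ for a Borel function $c:\mathbb{R}^2\to[0,\infty)$ ($I$ the $2\times2$ identity matrix), and $\nu(x,\cdot)$ is rotationally invariant. A symmetric Borel measure $\mu$ on $\mathbb{R}$ is quasi-unimodal (with respect to $u_0\ge0$) if $u\mapsto\mu((u,\infty))$ is a convex function on $(u_0,\infty)$. The measure $\nu(x,du\times\mathbb{R})$ is the projection of $\nu(x,\cdot)$ onto the first coordinate. Convention: $1/0=\infty$. *)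

theory Defs
  imports "HOL-Probability.Probability"
begin

section \<open>Function spaces\<close>

definition C_infty :: "('a::euclidean_space \<Rightarrow> real) set" where
  "C_infty = {f. continuous_on UNIV f \<and> (f \<longlongrightarrow> 0) at_infinity}"

primrec C_k :: "nat \<Rightarrow> ('a::euclidean_space \<Rightarrow> real) \<Rightarrow> bool" where
  "C_k 0 f \<longleftrightarrow> continuous_on UNIV f"
| "C_k (Suc k) f \<longleftrightarrow> f differentiable_on UNIV \<and>
     (\<forall>i\<in>Basis. C_k k (\<lambda>x. frechet_derivative f (at x) i))"

definition Cc_infty :: "('a::euclidean_space \<Rightarrow> real) set" where
  "Cc_infty = {f. (\<forall>k. C_k k f) \<and> compact (closure {x. f x \<noteq> 0})}"

section \<open>Semigroups on \<open>C_infty\<close> and their generators\<close>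

text \<open>Convergence in the sup norm is uniform convergence on the whole space.\<close>

definition strongly_continuous_semigroup ::
    "(real \<Rightarrow> ('a::euclidean_space \<Rightarrow> real) \<Rightarrow> ('a \<Rightarrow> real)) \<Rightarrow> bool" where
  "strongly_continuous_semigroup T \<longleftrightarrow>
     (\<forall>t\<ge>0. \<forall>f\<in>C_infty. T t f \<in> C_infty) \<and>
     (\<forall>t\<ge>0. \<forall>f\<in>C_infty. \<forall>g\<in>C_infty. \<forall>a b.
        T t (\<lambda>x. a * f x + b * g x) = (\<lambda>x. a * T t f x + b * T t g x)) \<and>
     (\<forall>t\<ge>0. \<exists>K. \<forall>f\<in>C_infty. \<forall>x. \<bar>T t f x\<bar> \<le> K * (SUP y. \<bar>f y\<bar>)) \<and>
     (\<forall>f\<in>C_infty. T 0 f = f) \<and>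
     (\<forall>s\<ge>0. \<forall>t\<ge>0. \<forall>f\<in>C_infty. T (s + t) f = T s (T t f)) \<and>
     (\<forall>f\<in>C_infty. uniform_limit UNIV (\<lambda>t. T t f) f (at_right 0))"

definition generator_domain ::
    "(real \<Rightarrow> ('a::euclidean_space \<Rightarrow> real) \<Rightarrow> ('a \<Rightarrow> real)) \<Rightarrow> ('a \<Rightarrow> real) set" where
  "generator_domain T = {f \<in> C_infty. \<exists>g\<in>C_infty.
     uniform_limit UNIV (\<lambda>t x. (T t f x - f x) / t) g (at_right 0)}"

text \<open>Only meaningful on \<open>generator_domain T\<close>, where the limit is uniform in \<open>x\<close>.\<close>

definition generator_op ::
    "(real \<Rightarrow> ('a::euclidean_space \<Rightarrow> real) \<Rightarrow> ('a \<Rightarrow> real)) \<Rightarrow> ('a \<Rightarrow> real) \<Rightarrow> ('a \<Rightarrow> real)" where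
  "generator_op T f = (\<lambda>x. Lim (at_right 0) (\<lambda>t. (T t f x - f x) / t))"

section \<open>Markov and Feller processes\<close>

definition natural_filtration ::
    "'w measure \<Rightarrow> (real \<Rightarrow> 'w \<Rightarrow> 'a::euclidean_space) \<Rightarrow> real \<Rightarrow> 'w measure" where
  "natural_filtration M F s =
     sigma (space M) {F u -` B \<inter> space M | u B. 0 \<le> u \<and> u \<le> s \<and> B \<in> sets borel}"

text \<open>
  \<open>M\<close> only supplies the underlying measurable space; the laws are the \<open>P x\<close>. The times are
  the nonnegative reals, so \<open>F t\<close> is irrelevant for \<open>t < 0\<close>. The Markov property is taken with
  respect to the natural filtration.
\<close>

definition markov_process ::
    "'w measure \<Rightarrow> ('a::euclidean_space \<Rightarrow> 'w measure) \<Rightarrow> (real \<Rightarrow> 'w \<Rightarrow> 'a) \<Rightarrow> bool" where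
  "markov_process M P F \<longleftrightarrow>
     P \<in> borel \<rightarrow>\<^sub>M prob_algebra M \<and>
     (\<forall>t\<ge>0. F t \<in> M \<rightarrow>\<^sub>M borel) \<and>
     (\<forall>x. AE \<omega> in P x. F 0 \<omega> = x) \<and>
     (\<forall>x. \<forall>s\<ge>0. \<forall>t\<ge>0. \<forall>B\<in>sets borel. AE \<omega> in P x.
        real_cond_exp (P x) (natural_filtration M F s) (indicator (F (s + t) -` B)) \<omega>
          = measure (P (F s \<omega>)) (F t -` B \<inter> space M))"

definition transition_op ::
    "('a::euclidean_space \<Rightarrow> 'w measure) \<Rightarrow> (real \<Rightarrow> 'w \<Rightarrow> 'a) \<Rightarrow> real \<Rightarrow> ('a \<Rightarrow> real) \<Rightarrow> ('a \<Rightarrow> real)" where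
  "transition_op P F t f = (\<lambda>x. \<integral>\<omega>. f (F t \<omega>) \<partial>P x)"

definition feller_process ::
    "'w measure \<Rightarrow> ('a::euclidean_space \<Rightarrow> 'w measure) \<Rightarrow> (real \<Rightarrow> 'w \<Rightarrow> 'a) \<Rightarrow> bool" where
  "feller_process M P F \<longleftrightarrow>
     markov_process M P F \<and> strongly_continuous_semigroup (transition_op P F)"

definition open_set_irreducible ::
    "'w measure \<Rightarrow> ('a::euclidean_space \<Rightarrow> 'w measure) \<Rightarrow> (real \<Rightarrow> 'w \<Rightarrow> 'a) \<Rightarrow> bool" where
  "open_set_irreducible M P F \<longleftrightarrow>
     (\<exists>\<phi>. sigma_finite_measure \<phi> \<and> sets \<phi> = sets borel \<and>
        (\<forall>U. open U \<and> U \<noteq> {} \<longrightarrow> emeasure \<phi> U > 0) \<and>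
        (\<forall>B\<in>sets borel. emeasure \<phi> B > 0 \<longrightarrow>
           (\<forall>x. (\<integral>\<^sup>+t\<in>{0..}. emeasure (P x) (F t -` B \<inter> space M) \<partial>lborel) > 0)))"

section \<open>Symbols and Levy-type processes\<close>

definition fourier_hat :: "('a::euclidean_space \<Rightarrow> real) \<Rightarrow> 'a \<Rightarrow> complex" where
  "fourier_hat f \<xi> = of_real (1 / (2 * pi) ^ DIM('a)) *
     (\<integral>x. exp (- \<i> * of_real (\<xi> \<bullet> x)) * of_real (f x) \<partial>lborel)"

text \<open>Negative definiteness in the sense of Berg--Forst and Jacob: all the matrices with entries
  \<open>\<psi> (\<xi> i) + cnj (\<psi> (\<xi> j)) - \<psi> (\<xi> i - \<xi> j)\<close> are Hermitian and nonnegative definite.\<close>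

definition negative_definite :: "('a::euclidean_space \<Rightarrow> complex) \<Rightarrow> bool" where
  "negative_definite \<psi> \<longleftrightarrow>
     (\<forall>n::nat. \<forall>\<xi> :: nat \<Rightarrow> 'a. \<forall>z :: nat \<Rightarrow> complex.
        (\<Sum>i<n. \<Sum>j<n. (\<psi> (\<xi> i) + cnj (\<psi> (\<xi> j)) - \<psi> (\<xi> i - \<xi> j)) * z i * cnj (z j)) \<in> \<real>\<^sub>\<ge>\<^sub>0)"

definition is_symbol ::
    "('a::euclidean_space \<Rightarrow> 'w measure) \<Rightarrow> (real \<Rightarrow> 'w \<Rightarrow> 'a) \<Rightarrow> ('a \<Rightarrow> 'a \<Rightarrow> complex) \<Rightarrow> bool" where
  "is_symbol P F q \<longleftrightarrow>
     (\<lambda>(x, \<xi>). q x \<xi>) \<in> borel_measurable borel \<and>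
     (\<forall>S. compact S \<longrightarrow> bounded ((\<lambda>(x, \<xi>). q x \<xi>) ` S)) \<and>
     (\<forall>x. continuous_on UNIV (q x) \<and> negative_definite (q x)) \<and>
     (\<forall>f\<in>Cc_infty. \<forall>x. of_real (generator_op (transition_op P F) f x) =
        - (\<integral>\<xi>. q x \<xi> * exp (\<i> * of_real (\<xi> \<bullet> x)) * fourier_hat f \<xi> \<partial>lborel))"

definition levy_type_process ::
    "'w measure \<Rightarrow> ('a::euclidean_space \<Rightarrow> 'w measure) \<Rightarrow> (real \<Rightarrow> 'w \<Rightarrow> 'a) \<Rightarrow>
     ('a \<Rightarrow> 'a \<Rightarrow> complex) \<Rightarrow> bool" where
  "levy_type_process M P F q \<longleftrightarrow>
     feller_process M P F \<and>
     Cc_infty \<subseteq> generator_domain (transition_op P F) \<and>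
     is_symbol P F q \<and>
     (\<exists>K>0. \<forall>\<xi> x. cmod (q x \<xi>) \<le> K * (1 + (norm \<xi>)\<^sup>2)) \<and>
     (\<forall>x. q x 0 = 0)"

definition levy_triplet ::
    "(real^'n \<Rightarrow> real^'n \<Rightarrow> complex) \<Rightarrow> (real^'n \<Rightarrow> real^'n) \<Rightarrow> (real^'n \<Rightarrow> real^'n^'n) \<Rightarrow>
     (real^'n \<Rightarrow> (real^'n) measure) \<Rightarrow> bool" where
  "levy_triplet q b C \<nu> \<longleftrightarrow>
     (\<forall>x. transpose (C x) = C x \<and> (\<forall>\<xi>. 0 \<le> \<xi> \<bullet> (C x *v \<xi>))) \<and>
     (\<forall>x. sets (\<nu> x) = sets borel) \<and>
     (\<forall>B\<in>sets borel. (\<lambda>x. emeasure (\<nu> x) B) \<in> borel_measurable borel) \<and>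
     (\<forall>x. emeasure (\<nu> x) {0} = 0) \<and>
     (\<forall>x. (\<integral>\<^sup>+y. ennreal (min 1 ((norm y)\<^sup>2)) \<partial>\<nu> x) < \<infinity>) \<and>
     (\<forall>x \<xi>. q x \<xi> =
        - \<i> * of_real (\<xi> \<bullet> b x) + of_real (1/2 * (\<xi> \<bullet> (C x *v \<xi>))) +
        (\<integral>y. (1 - exp (\<i> * of_real (\<xi> \<bullet> y)) + \<i> * of_real ((\<xi> \<bullet> y) * indicator (ball 0 1) y)) \<partial>\<nu> x))"

definition radial_in_covariable :: "(real^2 \<Rightarrow> real^2 \<Rightarrow> complex) \<Rightarrow> bool" where
  "radial_in_covariable q \<longleftrightarrow> (\<forall>R. rotation_matrix R \<longrightarrow> (\<forall>x \<xi>. q x (R *v \<xi>) = q x \<xi>))"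

section \<open>Quasi-unimodal measures\<close>

text \<open>The tail function is required to be real-valued on \<open>(u0, \<infinity>)\<close>: without the finiteness clause,
  infinite tails would be read as \<open>0\<close> by \<open>measure\<close>.\<close>

definition quasi_unimodal :: "real measure \<Rightarrow> real \<Rightarrow> bool" where
  "quasi_unimodal \<mu> u0 \<longleftrightarrow>
     sets \<mu> = sets borel \<and> distr \<mu> borel uminus = \<mu> \<and> 0 \<le> u0 \<and>
     (\<forall>u>u0. emeasure \<mu> {u<..} < \<infinity>) \<and>
     convex_on {u0<..} (\<lambda>u. measure \<mu> {u<..})"

definition tail_integral :: "(real^2) measure \<Rightarrow> real \<Rightarrow> ennreal" where
  "tail_integral \<nu> \<rho> = (\<integral>\<^sup>+u\<in>{0..\<rho>}. ennreal u * emeasure \<nu> (- ball 0 u) \<partial>lborel)"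

end

theory Submission
  imports Defs
begin

text \<open>Radiality in the co-variable makes each symbol even, hence real, so that
  \<open>q x \<xi> = c x / 2 * \<bar>\<xi>\<bar>\<^sup>2 + J x \<xi>\<close>, where \<open>J x \<xi>\<close> is the integral of \<open>1 - cos (\<xi> \<bullet> y)\<close> against \<open>\<nu> x\<close>.
  The whole theorem rests on the two-sided estimate
  \<open>\<bar>\<xi>\<bar>\<^sup>2 T x (1/\<bar>\<xi>\<bar>) / 30 \<le> J x \<xi> \<le> 4 \<bar>\<xi>\<bar>\<^sup>2 T x (1/\<bar>\<xi>\<bar>)\<close>, where \<open>T x \<rho>\<close> is the tail integral
  of \<open>u \<nu>(x, B\<^sub>u\<^sup>c)\<close> over \<open>[0, \<rho>]\<close>. Tonelli turns \<open>T x \<rho>\<close> into half the \<open>\<nu> x\<close>-integral of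
  \<open>min (\<rho>, \<bar>y\<bar>)\<^sup>2\<close>, and the upper bound is then the elementary bound on \<open>1 - cos\<close>.

  For the lower bound, \<open>J x\<close> is radial and satisfies \<open>J (\<xi> + \<eta>) \<le> 2 J \<xi> + 2 J \<eta>\<close>. In dimension at
  least two every vector of length at most \<open>\<bar>\<xi>\<bar>\<close> is a sum of two vectors of length \<open>\<bar>\<xi>\<bar>\<close>, so
  \<open>J \<le> 4 J \<xi>\<close> on each coordinate segment of length \<open>\<bar>\<xi>\<bar>\<close>. Averaging \<open>J\<close> along such a segment
  replaces the oscillating \<open>1 - cos\<close> by \<open>1 - sin z / z\<close>, which dominates \<open>2/15 * min (1, z)\<^sup>2\<close>;
  summing over the coordinates gives the truncated second moment.

  Polar coordinates together with \<open>\<rho> = 1/\<bar>\<xi>\<bar>\<close> transform the integral of \<open>1 / (\<bar>\<xi>\<bar>\<^sup>2 m (1/\<bar>\<xi>\<bar>))\<close> over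
  a disc into the integral of \<open>1 / (\<rho> m \<rho>)\<close> over a half-line. The lower estimate passes to suprema
  and infima over \<open>x\<close> directly. In the upper estimate the Gaussian part has to be absorbed: \<open>c\<close> is
  bounded by the quadratic growth condition, and the tail integral is nondecreasing in \<open>\<rho>\<close>, so the
  supremum of the tail integrals dominates a positive constant unless all jump measures vanish, in
  which case both integrals diverge like that of \<open>1/\<rho>\<close>. For the infima, the limit condition
  says that all tail integrals exceed 1 from some \<open>\<rho>\<close> on.\<close>

section \<open>Polar integration in the plane\<close>

text \<open>The superlevel sets are up-sets of the line, so their indicators are monotone real functions.\<close>

lemma borel_measurable_mono_ennreal:
  fixes m :: "real \<Rightarrow> ennreal"
  assumes "mono m"
  shows "m \<in> borel_measurable borel"
proof (rule borel_measurableI_greater)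
  fix a
  have "mono (\<lambda>\<rho>. indicator {\<rho>. a < m \<rho>} \<rho> :: real)"
    using assms by (auto simp: mono_def indicator_def intro: less_le_trans)
  from borel_measurable_mono[OF this] show "{\<rho> \<in> space borel. a < m \<rho>} \<in> sets borel"
    by (simp add: borel_measurable_indicator_iff)
qed

lemma nn_integral_inverse_cube_tail:
  assumes "0 < y"
  shows "(\<integral>\<^sup>+\<rho>. ennreal (2 * pi / \<rho> ^ 3) * indicator {y..} \<rho> \<partial>lborel) = ennreal (pi / y\<^sup>2)"
proof -
  have "(\<integral>\<^sup>+\<rho>. ennreal (2 * pi / \<rho> ^ 3) * indicator {y..} \<rho> \<partial>lborel) = ennreal (0 - (- pi / y\<^sup>2))"
  proof (rule nn_integral_FTC_atLeast)
    fix \<rho> assume "y \<le> \<rho>"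
    with assms show "((\<lambda>\<rho>. - pi / \<rho>\<^sup>2) has_real_derivative 2 * pi / \<rho> ^ 3) (at \<rho>)"
      by (auto intro!: derivative_eq_intros simp: power2_eq_square power3_eq_cube field_simps)
    show "0 \<le> 2 * pi / \<rho> ^ 3" using assms \<open>y \<le> \<rho>\<close> by simp
  next
    show "((\<lambda>\<rho>. - pi / \<rho>\<^sup>2) \<longlongrightarrow> 0) at_top"
      by (intro tendsto_divide_0[OF tendsto_const] filterlim_at_top_imp_at_infinity
          filterlim_pow_at_top filterlim_ident) simp
  qed simp
  then show ?thesis by simp
qed

text \<open>Integration in polar coordinates combined with the substitution \<open>\<rho> = 1/\<bar>\<xi>\<bar>\<close>. Both sides are
  integrals of \<open>G\<close> against measures on the line, which agree because each gives the half-line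
  beyond \<open>y \<ge> 1/r\<close> the mass \<open>\<pi> / y\<^sup>2\<close>, the area of the disc of radius \<open>1/y\<close>.\<close>

lemma nn_integral_ball_inverse_norm:
  fixes G :: "real \<Rightarrow> ennreal"
  assumes [measurable]: "G \<in> borel_measurable borel" and r: "0 < r"
  shows "(\<integral>\<^sup>+\<xi>\<in>ball (0::real^2) r. G (1 / norm \<xi>) \<partial>lborel)
       = (\<integral>\<^sup>+\<rho>\<in>{1/r..}. ennreal (2 * pi / \<rho> ^ 3) * G \<rho> \<partial>lborel)"
proof -
  have [measurable]: "ball (0::real^2) r \<in> sets borel" by simp
  let ?R = "density lborel (indicator (ball (0::real^2) r))"
  let ?M = "distr ?R borel (\<lambda>\<xi>. 1 / norm \<xi>)"
  let ?N = "density lborel (\<lambda>\<rho>. ennreal (2 * pi / \<rho> ^ 3) * indicator {1/r..} \<rho>)"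
  have M: "emeasure ?M {x<..} = ennreal (pi / (max x (1/r))\<^sup>2)" for x
  proof -
    define y where "y = max x (1/r)"
    have y: "0 < y" using r by (auto simp: y_def less_max_iff_disj)
    \<comment> \<open>The origin has to be left out, since there \<open>1 / norm \<xi>\<close> is \<open>0\<close> rather than \<open>\<infinity>\<close>.\<close>
    have eq: "indicator (ball 0 r) \<xi> * indicator ((\<lambda>\<xi>. 1 / norm \<xi>) -` {x<..}) \<xi>
        = (indicator (ball 0 (1/y)) \<xi> :: ennreal)" if "\<xi> \<noteq> 0" for \<xi> :: "real^2"
    proof -
      have "norm \<xi> < r \<and> x < 1 / norm \<xi> \<longleftrightarrow> norm \<xi> < 1 / y"
      proof -
        have "norm \<xi> < 1 / y \<longleftrightarrow> y < 1 / norm \<xi>"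
          using y that by (simp add: field_simps)
        also have "\<dots> \<longleftrightarrow> x < 1 / norm \<xi> \<and> 1 / r < 1 / norm \<xi>"
          by (simp add: y_def)
        also have "1 / r < 1 / norm \<xi> \<longleftrightarrow> norm \<xi> < r"
          using r that by (simp add: field_simps)
        finally show ?thesis by auto
      qed
      then show ?thesis by (auto simp: indicator_def)
    qed
    have "emeasure ?M {x<..} =
        (\<integral>\<^sup>+\<xi>. indicator (ball 0 r) \<xi> * indicator ((\<lambda>\<xi>. 1 / norm \<xi>) -` {x<..}) \<xi> \<partial>(lborel :: (real^2) measure))"
    proof (subst emeasure_distr)
      show "(\<lambda>\<xi>. 1 / norm \<xi>) \<in> ?R \<rightarrow>\<^sub>M borel" by simp
      show "emeasure ?R ((\<lambda>\<xi>. 1 / norm \<xi>) -` {x<..} \<inter> space ?R) =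
        (\<integral>\<^sup>+\<xi>. indicator (ball 0 r) \<xi> * indicator ((\<lambda>\<xi>. 1 / norm \<xi>) -` {x<..}) \<xi> \<partial>(lborel :: (real^2) measure))"
        using measurable_sets_borel[of "\<lambda>\<xi>::real^2. 1 / norm \<xi>" borel "{x<..}"]
        by (subst emeasure_density) (auto intro: borel_measurable_indicator)
    qed simp
    also have "\<dots> = (\<integral>\<^sup>+\<xi>. indicator (ball (0::real^2) (1/y)) \<xi> \<partial>lborel)"
      using AE_lborel_singleton[of "0::real^2"] by (intro nn_integral_cong_AE) (auto simp: eq elim!: eventually_mono)
    also have "\<dots> = ennreal (pi / y\<^sup>2)"
      using y by (simp add: emeasure_ball unit_ball_vol_2 power_divide)
    finally show ?thesis by (simp add: y_def)
  qed
  have N: "emeasure ?N {x<..} = ennreal (pi / (max x (1/r))\<^sup>2)" for x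
  proof -
    have "emeasure ?N {x<..} =
        (\<integral>\<^sup>+\<rho>. ennreal (2 * pi / \<rho> ^ 3) * indicator {1/r..} \<rho> * indicator {x<..} \<rho> \<partial>lborel)"
      by (subst emeasure_density) auto
    also have "\<dots> = (\<integral>\<^sup>+\<rho>. ennreal (2 * pi / \<rho> ^ 3) * indicator {max x (1/r)..} \<rho> \<partial>lborel)"
      using AE_lborel_singleton[of x]
      by (intro nn_integral_cong_AE) (auto simp: indicator_def elim!: eventually_mono)
    also have "\<dots> = ennreal (pi / (max x (1/r))\<^sup>2)"
      using r by (intro nn_integral_inverse_cube_tail) (auto simp: less_max_iff_disj)
    finally show ?thesis .
  qed
  have "?M = ?N"
    by (rule measure_eqI_lessThan) (simp_all only: M N, simp_all)
  then have "(\<integral>\<^sup>+\<rho>. G \<rho> \<partial>?M) = (\<integral>\<^sup>+\<rho>. G \<rho> \<partial>?N)" by simp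
  then show ?thesis
    by (simp add: nn_integral_distr nn_integral_density ac_simps)
qed

text \<open>The factor \<open>\<bar>\<xi>\<bar>\<^sup>2\<close> meets the density \<open>2 \<pi> / \<rho>\<^sup>3\<close>; this is where dimension two produces the
  logarithmic weight \<open>1/\<rho>\<close>.\<close>

lemma nn_integral_ball_inverse_quadratic:
  fixes m :: "real \<Rightarrow> ennreal"
  assumes m: "mono m" and k: "0 < k" and r: "0 < r"
  shows "(\<integral>\<^sup>+\<xi>\<in>ball (0::real^2) r. inverse (ennreal (k * (norm \<xi>)\<^sup>2) * m (1 / norm \<xi>)) \<partial>lborel)
       = ennreal (2 * pi / k) * (\<integral>\<^sup>+\<rho>\<in>{1/r..}. inverse (ennreal \<rho> * m \<rho>) \<partial>lborel)"
proof -
  note [measurable] = borel_measurable_mono_ennreal[OF m]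
  have "(\<integral>\<^sup>+\<xi>\<in>ball (0::real^2) r. inverse (ennreal (k * (norm \<xi>)\<^sup>2) * m (1 / norm \<xi>)) \<partial>lborel)
      = (\<integral>\<^sup>+\<xi>\<in>ball (0::real^2) r. (\<lambda>\<rho>. inverse (ennreal (k * (1 / \<rho>)\<^sup>2) * m \<rho>)) (1 / norm \<xi>) \<partial>lborel)"
    by simp
  also have "\<dots> = (\<integral>\<^sup>+\<rho>\<in>{1/r..}. ennreal (2 * pi / \<rho> ^ 3) * inverse (ennreal (k * (1 / \<rho>)\<^sup>2) * m \<rho>) \<partial>lborel)"
    by (rule nn_integral_ball_inverse_norm) (use r in auto)
  also have "\<dots> = (\<integral>\<^sup>+\<rho>. ennreal (2 * pi / k) * (inverse (ennreal \<rho> * m \<rho>) * indicator {1/r..} \<rho>) \<partial>lborel)"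
  proof (rule nn_integral_cong)
    fix \<rho> :: real
    show "ennreal (2 * pi / \<rho> ^ 3) * inverse (ennreal (k * (1 / \<rho>)\<^sup>2) * m \<rho>) * indicator {1/r..} \<rho>
        = ennreal (2 * pi / k) * (inverse (ennreal \<rho> * m \<rho>) * indicator {1/r..} \<rho>)"
    proof (cases "1/r \<le> \<rho>")
      case True
      with r have \<rho>: "0 < \<rho>" by (meson less_le_trans zero_less_divide_1_iff)
      then have "ennreal (2 * pi / \<rho> ^ 3) * inverse (ennreal (k * (1 / \<rho>)\<^sup>2))
          = ennreal (2 * pi / k) * inverse (ennreal \<rho>)"
        using k by (simp add: inverse_ennreal ennreal_mult[symmetric])
          (simp add: field_simps power2_eq_square power3_eq_cube)
      moreover have "inverse (ennreal (k * (1 / \<rho>)\<^sup>2) * m \<rho>) = inverse (ennreal (k * (1 / \<rho>)\<^sup>2)) * inverse (m \<rho>)"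
        using k \<rho> by (intro ennreal_inverse_mult') auto
      moreover have "inverse (ennreal \<rho> * m \<rho>) = inverse (ennreal \<rho>) * inverse (m \<rho>)"
        using \<rho> by (intro ennreal_inverse_mult') auto
      ultimately show ?thesis by (metis mult.assoc)
    qed simp
  qed
  also have "\<dots> = ennreal (2 * pi / k) * (\<integral>\<^sup>+\<rho>\<in>{1/r..}. inverse (ennreal \<rho> * m \<rho>) \<partial>lborel)"
    by (rule nn_integral_cmult) measurable
  finally show ?thesis .
qed

section \<open>Jump exponents and truncated second moments\<close>

text \<open>The contribution of the jumps to the real part of a Levy-Khintchine exponent.\<close>

definition jump_exponent :: "'a::euclidean_space measure \<Rightarrow> 'a \<Rightarrow> ennreal" where
  "jump_exponent N \<xi> = (\<integral>\<^sup>+y. ennreal (1 - cos (\<xi> \<bullet> y)) \<partial>N)"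

lemma one_minus_cos_le: "1 - cos (z::real) \<le> 2 * (min 1 \<bar>z\<bar>)\<^sup>2"
proof (cases "\<bar>z\<bar> \<le> 1")
  case True
  have "1 - cos z = 2 * (sin (z/2))\<^sup>2" using cos_double_sin[of "z/2"] by simp
  also have "\<dots> \<le> 2 * \<bar>z\<bar>\<^sup>2"
    using abs_sin_x_le_abs_x[of "z/2"] by (intro mult_left_mono) (auto intro!: abs_le_square_iff[THEN iffD1])
  finally show ?thesis using True by (simp add: min_absorb2)
next
  case False
  then show ?thesis using cos_ge_minus_one[of z] by (simp add: min_absorb1)
qed

text \<open>Since \<open>1 - cos z = 2 sin\<^sup>2 (z/2)\<close>, this is subadditivity of \<open>\<bar>sin\<bar>\<close> followed by
  \<open>(u + v)\<^sup>2 \<le> 2 u\<^sup>2 + 2 v\<^sup>2\<close>.\<close>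

lemma one_minus_cos_add_le: "1 - cos (a + b :: real) \<le> 2 * (1 - cos a) + 2 * (1 - cos b)"
proof -
  have s: "1 - cos z = 2 * (sin (z/2))\<^sup>2" for z :: real using cos_double_sin[of "z/2"] by simp
  have "\<bar>sin (a/2 + b/2)\<bar> \<le> \<bar>sin (a/2)\<bar> + \<bar>sin (b/2)\<bar>"
  proof -
    have "\<bar>sin (a/2 + b/2)\<bar> \<le> \<bar>sin (a/2)\<bar> * \<bar>cos (b/2)\<bar> + \<bar>cos (a/2)\<bar> * \<bar>sin (b/2)\<bar>"
      unfolding sin_add by (metis abs_mult abs_triangle_ineq)
    also have "\<dots> \<le> \<bar>sin (a/2)\<bar> + \<bar>sin (b/2)\<bar>"
      by (intro add_mono mult_right_le_one_le mult_left_le_one_le) auto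
    finally show ?thesis .
  qed
  then have "(sin (a/2 + b/2))\<^sup>2 \<le> (\<bar>sin (a/2)\<bar> + \<bar>sin (b/2)\<bar>)\<^sup>2"
    by (metis abs_ge_zero power2_abs power_mono)
  also have "\<dots> \<le> 2 * (sin (a/2))\<^sup>2 + 2 * (sin (b/2))\<^sup>2"
    using sum_squares_bound[of "\<bar>sin (a/2)\<bar>" "\<bar>sin (b/2)\<bar>"] by (simp add: power2_sum)
  finally show ?thesis unfolding s by (simp add: add_divide_distrib)
qed

text \<open>Up to \<open>z = 2\<close> the cubic Taylor polynomial of \<open>sin\<close>, with its remainder of order 5, gives
  \<open>1 - sin z / z \<ge> z\<^sup>2 / 6 - z\<^sup>4 / 120 \<ge> (1/6 - 4/120) z\<^sup>2\<close>, which is where \<open>2/15\<close> comes from;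
  beyond it \<open>sin z / z \<le> 1/2\<close>.\<close>

lemma one_minus_sinc_ge:
  fixes z :: real
  assumes "z > 0"
  shows "1 - sin z / z \<ge> 2/15 * (min 1 z)\<^sup>2"
proof (cases "z \<le> 2")
  case True
  have sums: "(\<Sum>m<5. sin_coeff m * z ^ m) = z - z ^ 3 / 6"
    by (simp add: sin_coeff_def lessThan_nat_numeral fact_numeral)
  have "\<bar>sin z - (z - z ^ 3 / 6)\<bar> \<le> z ^ 5 / 120"
    using Maclaurin_sin_bound[of z 5] assms unfolding sums by (simp add: eval_nat_numeral)
  then have "sin z \<le> z - z ^ 3 / 6 + z ^ 5 / 120" by linarith
  also have "\<dots> = z * (1 - z\<^sup>2 / 6 + z\<^sup>2 * z\<^sup>2 / 120)"
    by (simp add: eval_nat_numeral field_simps)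
  finally have "sin z \<le> z * (1 - z\<^sup>2 / 6 + z\<^sup>2 * z\<^sup>2 / 120)" .
  then have "sin z / z \<le> 1 - z\<^sup>2 / 6 + z\<^sup>2 * z\<^sup>2 / 120"
    using assms by (simp add: divide_le_eq mult.commute)
  moreover have "z\<^sup>2 * z\<^sup>2 \<le> z\<^sup>2 * 4"
    using power_mono[OF True, of 2] assms by (intro mult_left_mono) auto
  moreover have "(min 1 z)\<^sup>2 \<le> z\<^sup>2" using assms by (intro power_mono) auto
  ultimately show ?thesis by linarith
next
  case False
  then have "sin z / z \<le> 1 / 2"
    using sin_le_one[of z] by (auto simp: divide_le_eq intro: order_trans[of _ 2])
  moreover have "(min 1 z)\<^sup>2 = 1" using False by simp
  ultimately show ?thesis by simp
qed

text \<open>Unlike \<open>1 - cos\<close> itself, its mean over a segment does not return to zero.\<close>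

lemma nn_integral_one_minus_cos_ge:
  assumes t: "0 < t"
  shows "(\<integral>\<^sup>+v\<in>{0..t}. ennreal (1 - cos (v * z)) \<partial>lborel) \<ge> ennreal (2/15 * t * (min 1 (t * \<bar>z\<bar>))\<^sup>2)"
proof (cases "z = 0")
  case False
  have "(\<integral>\<^sup>+v\<in>{0..t}. ennreal (1 - cos (v * z)) \<partial>lborel)
      = ennreal ((t - sin (t * z) / z) - (0 - sin (0 * z) / z))"
    by (rule nn_integral_FTC_Icc)
      (use t False in \<open>auto intro!: derivative_eq_intros cos_le_one\<close>)
  also have "\<dots> = ennreal (t * (1 - sin (t * \<bar>z\<bar>) / (t * \<bar>z\<bar>)))"
    using t False by (intro arg_cong[of _ _ ennreal]) (auto simp: field_simps abs_if)
  finally show ?thesis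
    using mult_left_mono[OF one_minus_sinc_ge[of "t * \<bar>z\<bar>"], of t] t False
    by (auto intro!: ennreal_leI simp: ac_simps)
qed simp

locale levy_measure =
  fixes N :: "'a::euclidean_space measure"
  assumes sets_eq [measurable_cong, simp]: "sets N = sets borel"
    and null_origin: "emeasure N {0} = 0"
    and min_moment_finite: "(\<integral>\<^sup>+y. ennreal (min 1 ((norm y)\<^sup>2)) \<partial>N) < \<infinity>"
begin

lemma space_eq [simp]: "space N = UNIV"
  using sets_eq_imp_space_eq[OF sets_eq] by simp

lemma emeasure_outside_ball_finite:
  assumes "0 < e"
  shows "emeasure N {y. e \<le> norm y} < \<infinity>"
proof -
  define k where "k = min 1 (e\<^sup>2)"
  have k: "0 < k" using assms by (simp add: k_def)
  have "ennreal k * emeasure N {y. e \<le> norm y} = (\<integral>\<^sup>+y. ennreal k * indicator {y. e \<le> norm y} y \<partial>N)"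
    by (subst nn_integral_cmult_indicator) auto
  also have "\<dots> \<le> (\<integral>\<^sup>+y. ennreal (min 1 ((norm y)\<^sup>2)) \<partial>N)"
  proof (intro nn_integral_mono)
    fix y :: 'a
    have "e\<^sup>2 \<le> (norm y)\<^sup>2" if "e \<le> norm y" using that assms by (intro power_mono) auto
    then show "ennreal k * indicator {y. e \<le> norm y} y \<le> ennreal (min 1 ((norm y)\<^sup>2))"
      by (auto simp: k_def indicator_def intro!: ennreal_leI)
  qed
  finally have "ennreal k * emeasure N {y. e \<le> norm y} < \<infinity>"
    using min_moment_finite by (rule le_less_trans)
  then show ?thesis using k by (auto simp: ennreal_mult_less_top)
qed

lemma sigma_finite: "sigma_finite_measure N"
proof
  let ?A = "insert {0} (range (\<lambda>n. {y::'a. inverse (real (Suc n)) \<le> norm y}))"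
  have "\<Union>?A = UNIV"
  proof (intro equalityI subsetI UNIV_I)
    fix y :: 'a
    show "y \<in> \<Union>?A"
    proof (cases "y = 0")
      case False
      then obtain n where "inverse (real (Suc n)) < norm y" using reals_Archimedean[of "norm y"] by (auto simp del: of_nat_Suc)
      then show ?thesis by (auto intro!: exI[of _ n])
    qed simp
  qed
  moreover have "\<forall>a\<in>?A. emeasure N a \<noteq> \<infinity>"
    using emeasure_outside_ball_finite null_origin by (auto simp: less_top)
  moreover have "countable ?A" "?A \<subseteq> sets N" by auto
  ultimately show "\<exists>A. countable A \<and> A \<subseteq> sets N \<and> \<Union>A = space N \<and> (\<forall>a\<in>A. emeasure N a \<noteq> \<infinity>)"
    by (intro exI[of _ ?A]) simp
qed

lemma jump_exponent_add_le:
  "jump_exponent N (\<xi> + \<eta>) \<le> 2 * jump_exponent N \<xi> + 2 * jump_exponent N \<eta>"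
proof -
  have "jump_exponent N (\<xi> + \<eta>)
      \<le> (\<integral>\<^sup>+y. 2 * ennreal (1 - cos (\<xi> \<bullet> y)) + 2 * ennreal (1 - cos (\<eta> \<bullet> y)) \<partial>N)"
    unfolding jump_exponent_def
  proof (rule nn_integral_mono)
    fix y
    have "ennreal (1 - cos ((\<xi> + \<eta>) \<bullet> y)) \<le> ennreal (2 * (1 - cos (\<xi> \<bullet> y)) + 2 * (1 - cos (\<eta> \<bullet> y)))"
      unfolding inner_add_left by (intro ennreal_leI one_minus_cos_add_le)
    also have "\<dots> = 2 * ennreal (1 - cos (\<xi> \<bullet> y)) + 2 * ennreal (1 - cos (\<eta> \<bullet> y))"
      by (subst ennreal_plus) (auto simp: ennreal_mult' simp del: right_diff_distrib_numeral)
    finally show "ennreal (1 - cos ((\<xi> + \<eta>) \<bullet> y))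
        \<le> 2 * ennreal (1 - cos (\<xi> \<bullet> y)) + 2 * ennreal (1 - cos (\<eta> \<bullet> y))" .
  qed
  also have "\<dots> = 2 * jump_exponent N \<xi> + 2 * jump_exponent N \<eta>"
    unfolding jump_exponent_def by (subst nn_integral_add) (auto simp: nn_integral_cmult)
  finally show ?thesis .
qed

lemma jump_exponent_le_truncated:
  "jump_exponent N \<xi> \<le> 2 * (\<integral>\<^sup>+y. ennreal ((min 1 (norm \<xi> * norm y))\<^sup>2) \<partial>N)"
proof -
  have "jump_exponent N \<xi> \<le> (\<integral>\<^sup>+y. 2 * ennreal ((min 1 (norm \<xi> * norm y))\<^sup>2) \<partial>N)"
    unfolding jump_exponent_def
  proof (rule nn_integral_mono)
    fix y
    have "1 - cos (\<xi> \<bullet> y) \<le> 2 * (min 1 \<bar>\<xi> \<bullet> y\<bar>)\<^sup>2" by (rule one_minus_cos_le)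
    also have "\<dots> \<le> 2 * (min 1 (norm \<xi> * norm y))\<^sup>2"
      using Cauchy_Schwarz_ineq2[of \<xi> y] by (intro mult_left_mono power_mono) auto
    finally show "ennreal (1 - cos (\<xi> \<bullet> y)) \<le> 2 * ennreal ((min 1 (norm \<xi> * norm y))\<^sup>2)"
      by (metis ennreal_leI ennreal_mult' ennreal_numeral zero_le_numeral)
  qed
  then show ?thesis by (simp add: nn_integral_cmult)
qed

lemma segment_average_jump_exponent_ge:
  assumes "0 < t"
  shows "ennreal (2/15 * t) * (\<integral>\<^sup>+y. ennreal ((min 1 (t * \<bar>e \<bullet> y\<bar>))\<^sup>2) \<partial>N)
       \<le> (\<integral>\<^sup>+v\<in>{0..t}. jump_exponent N (v *\<^sub>R e) \<partial>lborel)"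
proof -
  interpret N: sigma_finite_measure N by (rule sigma_finite)
  interpret P: pair_sigma_finite lborel N ..
  have "ennreal (2/15 * t) * (\<integral>\<^sup>+y. ennreal ((min 1 (t * \<bar>e \<bullet> y\<bar>))\<^sup>2) \<partial>N)
      = (\<integral>\<^sup>+y. ennreal (2/15 * t * (min 1 (t * \<bar>e \<bullet> y\<bar>))\<^sup>2) \<partial>N)"
    using assms by (subst nn_integral_cmult[symmetric])
      (auto intro!: nn_integral_cong simp: ennreal_mult'[symmetric])
  also have "\<dots> \<le> (\<integral>\<^sup>+y. \<integral>\<^sup>+v. ennreal (1 - cos (v * (e \<bullet> y))) * indicator {0..t} v \<partial>lborel \<partial>N)"
    by (intro nn_integral_mono nn_integral_one_minus_cos_ge assms)
  also have "\<dots> = (\<integral>\<^sup>+v. \<integral>\<^sup>+y. ennreal (1 - cos (v * (e \<bullet> y))) * indicator {0..t} v \<partial>N \<partial>lborel)"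
    by (rule P.Fubini') measurable
  also have "\<dots> = (\<integral>\<^sup>+v\<in>{0..t}. jump_exponent N (v *\<^sub>R e) \<partial>lborel)"
    unfolding jump_exponent_def by (subst nn_integral_multc) auto
  finally show ?thesis .
qed

text \<open>A segment \<open>v e\<close>, \<open>0 \<le> v \<le> \<bar>\<xi>\<bar>\<close>, in a coordinate direction \<open>e\<close> is reached by sums of two vectors of
  length \<open>\<bar>\<xi>\<bar>\<close>, because there is a second direction \<open>f\<close> orthogonal to \<open>e\<close>: the orthogonal components
  \<open>w f\<close> and \<open>- w f\<close> cancel. Hence the value at \<open>\<xi>\<close> controls the averages over all coordinate
  segments, and these control the truncated second moment of every coordinate.\<close>

lemma jump_exponent_ge_truncated:
  assumes dim: "2 \<le> DIM('a)" and \<xi>: "\<xi> \<noteq> 0"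
    and radial: "\<And>\<eta>. norm \<eta> = norm \<xi> \<Longrightarrow> jump_exponent N \<eta> = jump_exponent N \<xi>"
  shows "(\<integral>\<^sup>+y. ennreal ((min 1 (norm \<xi> * norm y))\<^sup>2) \<partial>N) \<le> ennreal (30 * DIM('a)) * jump_exponent N \<xi>"
proof -
  define t where "t = norm \<xi>"
  have t: "0 < t" using \<xi> by (simp add: t_def)
  have segment: "jump_exponent N (v *\<^sub>R e) \<le> 4 * jump_exponent N \<xi>"
    if e: "e \<in> Basis" and v: "v \<in> {0..t}" for e :: 'a and v
  proof -
    obtain f :: 'a where f: "f \<in> Basis" "f \<noteq> e"
    proof -
      have "\<not> (Basis :: 'a set) \<subseteq> {e}"
        using dim card_mono[of "{e}" "Basis :: 'a set"] by auto
      then show ?thesis using that by blast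
    qed
    define w where "w = sqrt (t\<^sup>2 - (v/2)\<^sup>2)"
    have "(v/2)\<^sup>2 \<le> t\<^sup>2" using v t by (intro power_mono) auto
    then have w: "w\<^sup>2 = t\<^sup>2 - (v/2)\<^sup>2" by (simp add: w_def)
    have norm: "norm ((v/2) *\<^sub>R e + a *\<^sub>R f) = norm \<xi>" if "a\<^sup>2 = w\<^sup>2" for a
    proof -
      have "(norm ((v/2) *\<^sub>R e + a *\<^sub>R f))\<^sup>2 = (v/2)\<^sup>2 + a\<^sup>2"
        using e f by (simp add: power2_norm_eq_inner inner_add_left inner_add_right inner_Basis)
          (simp add: power2_eq_square)
      also have "\<dots> = t\<^sup>2" using w that by simp
      finally show ?thesis using t by (simp add: t_def)
    qed
    have "v *\<^sub>R e = ((v/2) *\<^sub>R e + w *\<^sub>R f) + ((v/2) *\<^sub>R e + (-w) *\<^sub>R f)"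
      by (simp flip: scaleR_add_left)
    then have "jump_exponent N (v *\<^sub>R e) \<le> 2 * jump_exponent N ((v/2) *\<^sub>R e + w *\<^sub>R f)
        + 2 * jump_exponent N ((v/2) *\<^sub>R e + (-w) *\<^sub>R f)"
      using jump_exponent_add_le by metis
    also have "\<dots> = 2 * jump_exponent N \<xi> + 2 * jump_exponent N \<xi>"
      using radial[OF norm, of w] radial[OF norm, of "- w"] by simp
    also have "\<dots> = 4 * jump_exponent N \<xi>"
      by (simp flip: distrib_right)
    finally show ?thesis .
  qed
  have coord: "(\<integral>\<^sup>+y. ennreal ((min 1 (t * \<bar>e \<bullet> y\<bar>))\<^sup>2) \<partial>N) \<le> ennreal 30 * jump_exponent N \<xi>"
    if e: "e \<in> Basis" for e :: 'a
  proof -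
    let ?I = "\<integral>\<^sup>+y. ennreal ((min 1 (t * \<bar>e \<bullet> y\<bar>))\<^sup>2) \<partial>N"
    have "ennreal (2/15 * t) * ?I \<le> (\<integral>\<^sup>+v\<in>{0..t}. jump_exponent N (v *\<^sub>R e) \<partial>lborel)"
      by (rule segment_average_jump_exponent_ge[OF t])
    also have "\<dots> \<le> (\<integral>\<^sup>+v\<in>{0..t}. 4 * jump_exponent N \<xi> \<partial>lborel)"
      using segment[OF e] by (intro nn_integral_mono) (auto simp: indicator_def)
    also have "\<dots> = 4 * jump_exponent N \<xi> * ennreal t"
      using t by (subst nn_integral_cmult_indicator) auto
    finally have "ennreal (15 / (2 * t)) * (ennreal (2/15 * t) * ?I)
        \<le> ennreal (15 / (2 * t)) * (4 * jump_exponent N \<xi> * ennreal t)"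
      by (rule mult_left_mono) simp
    moreover have "ennreal (15 / (2 * t)) * (ennreal (2/15 * t) * ?I) = ?I"
      using t by (simp add: mult.assoc[symmetric] ennreal_mult'[symmetric])
    moreover have "ennreal (15 / (2 * t)) * (4 * jump_exponent N \<xi> * ennreal t)
        = (ennreal (15 / (2 * t)) * ennreal 4 * ennreal t) * jump_exponent N \<xi>"
      by (simp add: ac_simps)
    moreover have "ennreal (15 / (2 * t)) * ennreal 4 * ennreal t = ennreal 30"
      using t by (simp add: ennreal_mult'[symmetric] del: ennreal_numeral)
    ultimately show ?thesis by simp
  qed
  have "(\<integral>\<^sup>+y. ennreal ((min 1 (t * norm y))\<^sup>2) \<partial>N)
      \<le> (\<integral>\<^sup>+y. (\<Sum>e\<in>Basis. ennreal ((min 1 (t * \<bar>e \<bullet> y\<bar>))\<^sup>2)) \<partial>N)"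
  proof (rule nn_integral_mono)
    fix y :: 'a
    have "(min 1 (t * norm y))\<^sup>2 \<le> (\<Sum>e\<in>Basis. (min 1 (t * \<bar>e \<bullet> y\<bar>))\<^sup>2)"
    proof (cases "\<exists>e\<in>Basis. 1 \<le> t * \<bar>e \<bullet> y\<bar>")
      case True
      then obtain e where e: "e \<in> Basis" "1 \<le> t * \<bar>e \<bullet> y\<bar>" by auto
      have "(min 1 (t * norm y))\<^sup>2 \<le> 1\<^sup>2" using t by (intro power_mono) auto
      also have "\<dots> = (min 1 (t * \<bar>e \<bullet> y\<bar>))\<^sup>2" using e by (simp add: min_absorb1)
      also have "\<dots> \<le> (\<Sum>e\<in>Basis. (min 1 (t * \<bar>e \<bullet> y\<bar>))\<^sup>2)"
        using e by (intro member_le_sum) auto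
      finally show ?thesis .
    next
      case False
      have "(min 1 (t * norm y))\<^sup>2 \<le> (t * norm y)\<^sup>2" using t by (intro power_mono) auto
      also have "\<dots> = t\<^sup>2 * (\<Sum>e\<in>Basis. (y \<bullet> e) * (y \<bullet> e))"
        unfolding power_mult_distrib power2_norm_eq_inner by (subst euclidean_inner) simp
      also have "\<dots> = (\<Sum>e\<in>Basis. (t * \<bar>e \<bullet> y\<bar>)\<^sup>2)"
        by (simp add: power_mult_distrib sum_distrib_left inner_commute flip: power2_eq_square)
      also have "\<dots> = (\<Sum>e\<in>Basis. (min 1 (t * \<bar>e \<bullet> y\<bar>))\<^sup>2)"
        using False by (intro sum.cong) (auto simp: min_absorb2)
      finally show ?thesis .
    qed
    then show "ennreal ((min 1 (t * norm y))\<^sup>2) \<le> (\<Sum>e\<in>Basis. ennreal ((min 1 (t * \<bar>e \<bullet> y\<bar>))\<^sup>2))"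
      by (subst sum_ennreal) (auto intro: ennreal_leI)
  qed
  also have "\<dots> = (\<Sum>e\<in>Basis. \<integral>\<^sup>+y. ennreal ((min 1 (t * \<bar>e \<bullet> y\<bar>))\<^sup>2) \<partial>N)"
    by (rule nn_integral_sum) measurable
  also have "\<dots> \<le> (\<Sum>e\<in>(Basis::'a set). ennreal 30 * jump_exponent N \<xi>)"
    by (intro sum_mono coord)
  also have "\<dots> = ennreal (30 * DIM('a)) * jump_exponent N \<xi>"
    by (simp add: ennreal_mult' ennreal_of_nat_eq_real_of_nat ac_simps)
  finally show ?thesis by (simp add: t_def)
qed

text \<open>Inside the unit ball the integrand is the second-order Taylor remainder of \<open>iexp\<close>, outside it is
  bounded by 2.\<close>

lemma levy_khintchine_integrable:
  "integrable N (\<lambda>y. 1 - exp (\<i> * of_real (\<xi> \<bullet> y)) + \<i> * of_real ((\<xi> \<bullet> y) * indicator (ball 0 1) y))"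
proof (rule integrableI_bounded)
  let ?f = "\<lambda>y. 1 - exp (\<i> * complex_of_real (\<xi> \<bullet> y)) + \<i> * of_real ((\<xi> \<bullet> y) * indicator (ball 0 1) y)"
  have [measurable]: "ball (0::'a) 1 \<in> sets borel" by simp
  show "?f \<in> borel_measurable N" by measurable
  define k where "k = 2 + (norm \<xi>)\<^sup>2"
  have bound: "cmod (?f y) \<le> k * min 1 ((norm y)\<^sup>2)" for y
  proof (cases "norm y < 1")
    case True
    have sq: "(norm y)\<^sup>2 \<le> 1\<^sup>2" using True by (intro power_mono) auto
    have "cmod (?f y) = cmod (iexp (\<xi> \<bullet> y) - (\<Sum>k\<le>1. (\<i> * of_real (\<xi> \<bullet> y)) ^ k / fact k))"
      using True by (subst norm_minus_commute) (simp add: algebra_simps)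
    also have "\<dots> \<le> \<bar>\<xi> \<bullet> y\<bar>\<^sup>2 / 2"
      using iexp_approx1[of "\<xi> \<bullet> y" 1] by (simp add: numeral_2_eq_2)
    also have "\<dots> \<le> (norm \<xi> * norm y)\<^sup>2"
      using power_mono[OF Cauchy_Schwarz_ineq2[of \<xi> y], of 2]
        zero_le_power2[of "norm \<xi> * norm y"] unfolding power2_abs by linarith
    also have "\<dots> \<le> k * (norm y)\<^sup>2"
      by (simp add: k_def power_mult_distrib mult_right_mono)
    finally show ?thesis using sq by simp
  next
    case False
    then have "1\<^sup>2 \<le> (norm y)\<^sup>2" by (intro power_mono) auto
    moreover have "cmod (?f y) \<le> 2"
      using False norm_triangle_ineq4[of 1 "exp (\<i> * complex_of_real (\<xi> \<bullet> y))"] by simp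
    ultimately show ?thesis by (simp add: k_def add_increasing2)
  qed
  have k: "0 \<le> k" by (simp add: k_def)
  have "(\<integral>\<^sup>+y. ennreal (cmod (?f y)) \<partial>N) \<le> (\<integral>\<^sup>+y. ennreal k * ennreal (min 1 ((norm y)\<^sup>2)) \<partial>N)"
    using bound k by (intro nn_integral_mono) (metis ennreal_leI ennreal_mult')
  also have "\<dots> = ennreal k * (\<integral>\<^sup>+y. ennreal (min 1 ((norm y)\<^sup>2)) \<partial>N)"
    by (rule nn_integral_cmult) measurable
  also have "\<dots> < \<infinity>"
    using min_moment_finite by (simp add: ennreal_mult_less_top)
  finally show "(\<integral>\<^sup>+y. ennreal (cmod (?f y)) \<partial>N) < \<infinity>" .
qed

definition levy_khintchine :: "'a \<Rightarrow> complex" where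
  "levy_khintchine \<xi> = (\<integral>y. (1 - exp (\<i> * of_real (\<xi> \<bullet> y)) + \<i> * of_real ((\<xi> \<bullet> y) * indicator (ball 0 1) y)) \<partial>N)"

lemma Re_levy_khintchine:
  "0 \<le> Re (levy_khintchine \<xi>)" "ennreal (Re (levy_khintchine \<xi>)) = jump_exponent N \<xi>"
proof -
  have eq: "Re (1 - exp (\<i> * of_real (\<xi> \<bullet> y)) + \<i> * of_real ((\<xi> \<bullet> y) * indicator (ball 0 1) y)) = 1 - cos (\<xi> \<bullet> y)" for y
    by (simp add: Re_exp)
  have int: "integrable N (\<lambda>y. 1 - cos (\<xi> \<bullet> y))"
    using integrable_Re[OF levy_khintchine_integrable[of \<xi>]] by (simp only: eq)
  have Re: "Re (levy_khintchine \<xi>) = (\<integral>y. 1 - cos (\<xi> \<bullet> y) \<partial>N)"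
    unfolding levy_khintchine_def integral_Re[OF levy_khintchine_integrable, symmetric] eq ..
  show "0 \<le> Re (levy_khintchine \<xi>)" unfolding Re by (rule integral_nonneg_AE) simp
  show "ennreal (Re (levy_khintchine \<xi>)) = jump_exponent N \<xi>"
    unfolding Re jump_exponent_def by (rule nn_integral_eq_integral[symmetric, OF int]) simp
qed

lemma Im_levy_khintchine_minus: "Im (levy_khintchine (- \<xi>)) = - Im (levy_khintchine \<xi>)"
  unfolding levy_khintchine_def integral_Im[OF levy_khintchine_integrable, symmetric]
  by (subst Bochner_Integration.integral_minus[symmetric])
    (auto intro!: Bochner_Integration.integral_cong simp: Im_exp)

end

text \<open>The layer-cake formula: \<open>u\<close> contributes for those \<open>y\<close> with \<open>u \<le> norm y\<close>, and integrating \<open>u\<close> up to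
  \<open>min \<rho> (norm y)\<close> gives half the square. The outer maximum with 0 covers negative \<open>\<rho>\<close>, for which
  the left-hand side is an integral over the empty set.\<close>

lemma tail_integral_eq:
  assumes "levy_measure N"
  shows "2 * tail_integral N \<rho> = (\<integral>\<^sup>+y. ennreal ((min (max 0 \<rho>) (norm y))\<^sup>2) \<partial>N)"
proof -
  interpret levy_measure N by fact
  interpret N: sigma_finite_measure N by (rule sigma_finite)
  interpret P: pair_sigma_finite N lborel ..
  have "tail_integral N \<rho> = (\<integral>\<^sup>+u. (\<integral>\<^sup>+y. ennreal u * indicator {0..\<rho>} u * (if u \<le> norm y then 1 else 0) \<partial>N) \<partial>lborel)"
    unfolding tail_integral_def
  proof (rule nn_integral_cong)
    fix u :: real
    have "emeasure N (- ball 0 u) = (\<integral>\<^sup>+y. indicator (- ball 0 u) y \<partial>N)" by simp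
    also have "\<dots> = (\<integral>\<^sup>+y. (if u \<le> norm y then 1 else 0) \<partial>N)"
      by (intro nn_integral_cong) (auto simp: indicator_def)
    finally show "ennreal u * emeasure N (- ball 0 u) * indicator {0..\<rho>} u
        = (\<integral>\<^sup>+y. ennreal u * indicator {0..\<rho>} u * (if u \<le> norm y then 1 else 0) \<partial>N)"
      by (subst nn_integral_cmult) (auto simp: ac_simps)
  qed
  also have "\<dots> = (\<integral>\<^sup>+y. (\<integral>\<^sup>+u. ennreal u * indicator {0..\<rho>} u * (if u \<le> norm y then 1 else 0) \<partial>lborel) \<partial>N)"
    by (rule P.Fubini') measurable
  also have "\<dots> = (\<integral>\<^sup>+y. ennreal ((min (max 0 \<rho>) (norm y))\<^sup>2 / 2) \<partial>N)"
  proof (rule nn_integral_cong)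
    fix y :: "real^2"
    let ?s = "min (max 0 \<rho>) (norm y)"
    have "(\<integral>\<^sup>+u. ennreal u * indicator {0..\<rho>} u * (if u \<le> norm y then 1 else 0) \<partial>lborel)
        = (\<integral>\<^sup>+u. ennreal u * indicator {0..?s} u \<partial>lborel)"
      by (intro nn_integral_cong) (auto simp: indicator_def)
    also have "\<dots> = ennreal (?s\<^sup>2 / 2 - 0\<^sup>2 / 2)"
      by (rule nn_integral_FTC_Icc) (auto intro!: derivative_eq_intros)
    finally show "(\<integral>\<^sup>+u. ennreal u * indicator {0..\<rho>} u * (if u \<le> norm y then 1 else 0) \<partial>lborel)
        = ennreal (?s\<^sup>2 / 2)" by simp
  qed
  finally have "2 * tail_integral N \<rho> = (\<integral>\<^sup>+y. 2 * ennreal ((min (max 0 \<rho>) (norm y))\<^sup>2 / 2) \<partial>N)"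
    by (simp add: nn_integral_cmult)
  also have "\<dots> = (\<integral>\<^sup>+y. ennreal ((min (max 0 \<rho>) (norm y))\<^sup>2) \<partial>N)"
  proof (rule nn_integral_cong)
    fix y :: "real^2"
    have "2 * ennreal (s / 2) = ennreal s" for s
      using ennreal_mult'[of 2 "s/2"] by simp
    then show "2 * ennreal ((min (max 0 \<rho>) (norm y))\<^sup>2 / 2) = ennreal ((min (max 0 \<rho>) (norm y))\<^sup>2)" .
  qed
  finally show ?thesis .
qed

lemma mono_tail_integral: "mono (tail_integral N)"
  unfolding tail_integral_def by (intro monoI nn_integral_mono) (auto simp: indicator_def)

text \<open>A vanishing tail integral forces \<open>N\<close> to vanish off the origin, hence everywhere.\<close>

lemma tail_integral_eq_0:
  assumes N: "levy_measure N" and "0 < \<rho>" "tail_integral N \<rho> = 0"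
  shows "tail_integral N \<rho>' = 0"
proof -
  interpret levy_measure N by fact
  have "(\<integral>\<^sup>+y. ennreal ((min (max 0 \<rho>) (norm y))\<^sup>2) \<partial>N) = 0"
    using tail_integral_eq[OF N, of \<rho>] assms by simp
  then have "AE y in N. ennreal ((min (max 0 \<rho>) (norm y))\<^sup>2) = 0"
    by (subst (asm) nn_integral_0_iff_AE) auto
  then have "AE y in N. ennreal ((min (max 0 \<rho>') (norm y))\<^sup>2) = 0"
  proof (rule eventually_mono)
    fix y :: "real^2"
    assume "ennreal ((min (max 0 \<rho>) (norm y))\<^sup>2) = 0"
    then have "min \<rho> (norm y) = 0" using \<open>0 < \<rho>\<close> by simp
    then have "norm y = 0" using \<open>0 < \<rho>\<close> by (auto simp: min_def split: if_splits)
    then show "ennreal ((min (max 0 \<rho>') (norm y))\<^sup>2) = 0" by simp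
  qed
  then have "(\<integral>\<^sup>+y. ennreal ((min (max 0 \<rho>') (norm y))\<^sup>2) \<partial>N) = 0"
    by (subst nn_integral_0_iff_AE) auto
  then show ?thesis using tail_integral_eq[OF N, of \<rho>'] by simp
qed

lemma truncated_moment_eq_tail_integral:
  assumes N: "levy_measure N" and t: "0 < t"
  shows "(\<integral>\<^sup>+y. ennreal ((min 1 (t * norm y))\<^sup>2) \<partial>N) = ennreal (2 * t\<^sup>2) * tail_integral N (1 / t)"
proof -
  interpret levy_measure N by fact
  have "ennreal (2 * t\<^sup>2) * tail_integral N (1 / t) = ennreal (t\<^sup>2) * (2 * tail_integral N (1 / t))"
    by (simp add: ennreal_mult' ac_simps)
  also have "\<dots> = (\<integral>\<^sup>+y. ennreal (t\<^sup>2) * ennreal ((min (max 0 (1 / t)) (norm y))\<^sup>2) \<partial>N)"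
    unfolding tail_integral_eq[OF N] by (rule nn_integral_cmult[symmetric]) measurable
  also have "\<dots> = (\<integral>\<^sup>+y. ennreal ((min 1 (t * norm y))\<^sup>2) \<partial>N)"
  proof (rule nn_integral_cong)
    fix y :: "real^2"
    have "t * min (1 / t) (norm y) = min 1 (t * norm y)"
      using t by (simp add: min_def field_simps)
    then have "t\<^sup>2 * (min (max 0 (1 / t)) (norm y))\<^sup>2 = (min 1 (t * norm y))\<^sup>2"
      using t by (metis max_absorb2 power_mult_distrib less_imp_le zero_less_divide_1_iff)
    then show "ennreal (t\<^sup>2) * ennreal ((min (max 0 (1 / t)) (norm y))\<^sup>2) = ennreal ((min 1 (t * norm y))\<^sup>2)"
      by (metis ennreal_mult' zero_le_power2)
  qed
  finally show ?thesis ..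
qed

lemma jump_exponent_le_tail_integral:
  assumes N: "levy_measure N" and \<xi>: "\<xi> \<noteq> 0"
  shows "jump_exponent N \<xi> \<le> ennreal (4 * (norm \<xi>)\<^sup>2) * tail_integral N (1 / norm \<xi>)"
proof -
  have "jump_exponent N \<xi> \<le> 2 * (ennreal (2 * (norm \<xi>)\<^sup>2) * tail_integral N (1 / norm \<xi>))"
    using levy_measure.jump_exponent_le_truncated[OF N, of \<xi>] truncated_moment_eq_tail_integral[OF N, of "norm \<xi>"] \<xi>
    by simp
  also have "\<dots> = ennreal (4 * (norm \<xi>)\<^sup>2) * tail_integral N (1 / norm \<xi>)"
    using ennreal_mult'[of 2 "2 * (norm \<xi>)\<^sup>2"] by (simp add: mult.assoc[symmetric])
  finally show ?thesis .
qed

lemma tail_integral_le_radial_jump_exponent: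
  assumes N: "levy_measure N" and \<xi>: "\<xi> \<noteq> 0"
    and radial: "\<And>\<eta>. norm \<eta> = norm \<xi> \<Longrightarrow> jump_exponent N \<eta> = jump_exponent N \<xi>"
  shows "ennreal (1/30 * (norm \<xi>)\<^sup>2) * tail_integral N (1 / norm \<xi>) \<le> jump_exponent N \<xi>"
proof -
  have "ennreal (2 * (norm \<xi>)\<^sup>2) * tail_integral N (1 / norm \<xi>) \<le> ennreal 60 * jump_exponent N \<xi>"
    using levy_measure.jump_exponent_ge_truncated[OF N _ \<xi> radial] truncated_moment_eq_tail_integral[OF N, of "norm \<xi>"] \<xi>
    by simp
  then have "ennreal (1/60) * (ennreal (2 * (norm \<xi>)\<^sup>2) * tail_integral N (1 / norm \<xi>))
      \<le> ennreal (1/60) * (ennreal 60 * jump_exponent N \<xi>)"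
    by (rule mult_left_mono) simp
  then show ?thesis
    by (simp add: mult.assoc[symmetric] ennreal_mult'[symmetric] del: ennreal_numeral)
qed

section \<open>Integral criteria for comparable families\<close>

lemma inverse_ennreal_antimono:
  fixes a b :: ennreal
  assumes "a \<le> b"
  shows "inverse b \<le> inverse a"
proof (cases "a = 0 \<or> b = top")
  case False
  with assms obtain r s where "a = ennreal r" "b = ennreal s" "0 < r" "r \<le> s"
    by (cases a; cases b) (auto simp: top_unique)
  then show ?thesis by (auto simp: inverse_ennreal intro!: ennreal_leI le_imp_inverse_le)
qed auto

lemma nn_integral_ball_inverse_le:
  fixes m :: "real \<Rightarrow> ennreal"
  assumes "mono m" "0 < k" "0 < r"
    and le: "\<And>\<xi>. norm \<xi> < r \<Longrightarrow> ennreal (k * (norm \<xi>)\<^sup>2) * m (1 / norm \<xi>) \<le> Q \<xi>"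
  shows "(\<integral>\<^sup>+\<xi>\<in>ball (0::real^2) r. inverse (Q \<xi>) \<partial>lborel)
       \<le> ennreal (2 * pi / k) * (\<integral>\<^sup>+\<rho>\<in>{1/r..}. inverse (ennreal \<rho> * m \<rho>) \<partial>lborel)"
  unfolding nn_integral_ball_inverse_quadratic[OF assms(1-3), symmetric]
  by (intro nn_integral_mono) (auto simp: indicator_def intro!: inverse_ennreal_antimono le)

lemma nn_integral_ball_inverse_ge:
  fixes m :: "real \<Rightarrow> ennreal"
  assumes "mono m" "0 < k" "0 < r"
    and ge: "\<And>\<xi>. norm \<xi> < r \<Longrightarrow> Q \<xi> \<le> ennreal (k * (norm \<xi>)\<^sup>2) * m (1 / norm \<xi>)"
  shows "ennreal (2 * pi / k) * (\<integral>\<^sup>+\<rho>\<in>{1/r..}. inverse (ennreal \<rho> * m \<rho>) \<partial>lborel)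
       \<le> (\<integral>\<^sup>+\<xi>\<in>ball (0::real^2) r. inverse (Q \<xi>) \<partial>lborel)"
  unfolding nn_integral_ball_inverse_quadratic[OF assms(1-3), symmetric]
  by (intro nn_integral_mono) (auto simp: indicator_def intro!: inverse_ennreal_antimono ge)

lemma nn_integral_inverse_atLeast:
  assumes r: "0 < r"
  shows "(\<integral>\<^sup>+\<rho>\<in>{r..}. inverse (ennreal \<rho>) \<partial>lborel) = \<infinity>"
proof -
  have "ennreal R \<le> (\<integral>\<^sup>+\<rho>\<in>{r..}. inverse (ennreal \<rho>) \<partial>lborel)" if "0 \<le> R" for R
  proof -
    have "ennreal R = ennreal (ln (r * exp R) - ln r)"
      using r by (simp add: ln_mult)
    also have "\<dots> = (\<integral>\<^sup>+\<rho>. ennreal (1 / \<rho>) * indicator {r..r * exp R} \<rho> \<partial>lborel)"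
      by (rule nn_integral_FTC_Icc[symmetric])
        (use r that in \<open>auto intro!: derivative_eq_intros\<close>)
    also have "\<dots> \<le> (\<integral>\<^sup>+\<rho>\<in>{r..}. inverse (ennreal \<rho>) \<partial>lborel)"
      using r by (intro nn_integral_mono) (auto simp: indicator_def inverse_ennreal inverse_eq_divide)
    finally show ?thesis .
  qed
  then have "of_nat n \<le> (\<integral>\<^sup>+\<rho>\<in>{r..}. inverse (ennreal \<rho>) \<partial>lborel)" for n
    by (simp add: ennreal_of_nat_eq_real_of_nat)
  then show ?thesis
    using ennreal_Ex_less_of_nat by (metis infinity_ennreal_def less_top linorder_not_less)
qed

text \<open>Between two starting points the integrand is bounded by its value at the left one, which is finite
  unless \<open>m\<close> vanishes identically; in that case the integrand is \<open>\<infinity>\<close> throughout.\<close>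

lemma tail_divergence_independent_of_start:
  fixes m :: "real \<Rightarrow> ennreal"
  assumes m: "mono m" and zero: "\<And>\<rho> \<rho>'. 0 < \<rho> \<Longrightarrow> m \<rho> = 0 \<Longrightarrow> m \<rho>' = 0"
    and r: "0 < r" and s: "0 < s"
    and div: "(\<integral>\<^sup>+\<rho>\<in>{r..}. inverse (ennreal \<rho> * m \<rho>) \<partial>lborel) = \<infinity>"
  shows "(\<integral>\<^sup>+\<rho>\<in>{s..}. inverse (ennreal \<rho> * m \<rho>) \<partial>lborel) = \<infinity>"
proof (cases "m r = 0")
  case True
  then have "m \<rho> = 0" for \<rho> using zero r by blast
  then have "(\<integral>\<^sup>+\<rho>\<in>{s..}. inverse (ennreal \<rho>) \<partial>lborel) \<le> (\<integral>\<^sup>+\<rho>\<in>{s..}. inverse (ennreal \<rho> * m \<rho>) \<partial>lborel)"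
    by (intro nn_integral_mono) (auto simp: indicator_def)
  then show ?thesis using nn_integral_inverse_atLeast[OF s] by (simp add: top_unique)
next
  case False
  note [measurable] = borel_measurable_mono_ennreal[OF m]
  let ?f = "\<lambda>\<rho>. inverse (ennreal \<rho> * m \<rho>)"
  have "(\<integral>\<^sup>+\<rho>\<in>{r..}. ?f \<rho> \<partial>lborel) \<le> (\<integral>\<^sup>+\<rho>. ?f r * indicator {r..s} \<rho> + ?f \<rho> * indicator {s..} \<rho> \<partial>lborel)"
  proof (rule nn_integral_mono)
    fix \<rho>
    have "?f \<rho> \<le> ?f r" if "r \<le> \<rho>"
      using that by (intro inverse_ennreal_antimono mult_mono monoD[OF m] ennreal_leI) auto
    then show "?f \<rho> * indicator {r..} \<rho> \<le> ?f r * indicator {r..s} \<rho> + ?f \<rho> * indicator {s..} \<rho>"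
      by (auto simp: indicator_def)
  qed
  also have "\<dots> = ?f r * emeasure lborel {r..s} + (\<integral>\<^sup>+\<rho>\<in>{s..}. ?f \<rho> \<partial>lborel)"
    by (subst nn_integral_add) (auto simp: nn_integral_cmult_indicator)
  finally have "?f r * emeasure lborel {r..s} + (\<integral>\<^sup>+\<rho>\<in>{s..}. ?f \<rho> \<partial>lborel) = \<infinity>"
    using div by (simp add: top_unique)
  moreover have "?f r \<noteq> \<infinity>" using False r by simp
  moreover have "emeasure lborel {r..s} \<noteq> \<infinity>" by (cases "r \<le> s") auto
  ultimately show ?thesis by (auto simp: ennreal_mult_eq_top_iff)
qed

text \<open>The analytic content of the criteria: \<open>Q\<close> is the family of symbols and \<open>T\<close> that of tail integrals.
  The summand 1 in the upper estimate stands for a bounded Gaussian part, which is absent from the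
  lower one; the two criteria differ only in how they absorb it into \<open>T\<close>.\<close>

locale comparable_family =
  fixes Q :: "'i \<Rightarrow> real^2 \<Rightarrow> ennreal" and T :: "'i \<Rightarrow> real \<Rightarrow> ennreal" and k K :: real
  assumes mono_T: "\<And>x. mono (T x)"
    and T_eq_0: "\<And>x \<rho> \<rho>'. 0 < \<rho> \<Longrightarrow> T x \<rho> = 0 \<Longrightarrow> T x \<rho>' = 0"
    and k_pos: "0 < k" and K_pos: "0 < K"
    and lower: "\<And>x \<xi>. ennreal (k * (norm \<xi>)\<^sup>2) * T x (1 / norm \<xi>) \<le> Q x \<xi>"
    and upper: "\<And>x \<xi>. Q x \<xi> \<le> ennreal (K * (norm \<xi>)\<^sup>2) * (1 + T x (1 / norm \<xi>))"
begin

lemma SUP_lower: "ennreal (k * (norm \<xi>)\<^sup>2) * (SUP x. T x (1 / norm \<xi>)) \<le> (SUP x. Q x \<xi>)"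
  unfolding SUP_mult_left_ennreal by (intro SUP_mono) (use lower in auto)

lemma mono_SUP: "mono (\<lambda>\<rho>. SUP x. T x \<rho>)"
  by (intro monoI SUP_mono) (use mono_T in \<open>auto simp: mono_def\<close>)

lemma mono_INF: "mono (\<lambda>\<rho>. INF x. T x \<rho>)"
  by (intro monoI INF_mono) (use mono_T in \<open>auto simp: mono_def\<close>)

lemma SUP_eq_0: "(SUP x. T x \<rho>') = 0" if "0 < \<rho>" "(SUP x. T x \<rho>) = 0"
proof -
  have "T x \<rho> = 0" for x
    using that(2) SUP_upper[of x UNIV "\<lambda>x. T x \<rho>"] by simp
  then have "T x \<rho>' = 0" for x using T_eq_0 that(1) by blast
  then show ?thesis by simp
qed

lemma tail_SUP_independent_of_start:
  "(\<exists>r>0. (\<integral>\<^sup>+\<rho>\<in>{r..}. inverse (ennreal \<rho> * (SUP x. T x \<rho>)) \<partial>lborel) = \<infinity>) \<longleftrightarrow>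
   (\<forall>r>0. (\<integral>\<^sup>+\<rho>\<in>{r..}. inverse (ennreal \<rho> * (SUP x. T x \<rho>)) \<partial>lborel) = \<infinity>)"
proof -
  have "(\<integral>\<^sup>+\<rho>\<in>{s..}. inverse (ennreal \<rho> * (SUP x. T x \<rho>)) \<partial>lborel) = \<infinity>"
    if "0 < r" "0 < s" "(\<integral>\<^sup>+\<rho>\<in>{r..}. inverse (ennreal \<rho> * (SUP x. T x \<rho>)) \<partial>lborel) = \<infinity>" for r s
    by (rule tail_divergence_independent_of_start[OF mono_SUP _ that]) (rule SUP_eq_0)
  then show ?thesis using zero_less_one by blast
qed

text \<open>As the supremum of the \<open>T x\<close> is nondecreasing, it is bounded below by its value at 1 on
  \<open>\<rho> \<ge> 1\<close>, that is for \<open>\<bar>\<xi>\<bar> \<le> 1\<close>. If that value is positive, it absorbs the summand 1. If it is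
  zero, then all \<open>T x\<close> vanish, and the upper estimate alone makes the integral over the disc diverge.\<close>

lemma SUP_criterion:
  "(\<exists>r>0. (\<integral>\<^sup>+\<xi>\<in>ball 0 r. inverse (SUP x. Q x \<xi>) \<partial>lborel) = \<infinity>) \<longleftrightarrow>
   (\<exists>r>0. (\<integral>\<^sup>+\<rho>\<in>{r..}. inverse (ennreal \<rho> * (SUP x. T x \<rho>)) \<partial>lborel) = \<infinity>)"
  (is "?ball \<longleftrightarrow> ?tail")
proof
  assume ?ball
  then obtain r where r: "0 < r" and div: "(\<integral>\<^sup>+\<xi>\<in>ball 0 r. inverse (SUP x. Q x \<xi>) \<partial>lborel) = \<infinity>" by auto
  from nn_integral_ball_inverse_le[OF mono_SUP k_pos r SUP_lower] div
  have "ennreal (2 * pi / k) * (\<integral>\<^sup>+\<rho>\<in>{1/r..}. inverse (ennreal \<rho> * (SUP x. T x \<rho>)) \<partial>lborel) = \<infinity>"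
    by (simp add: top_unique)
  then have "(\<integral>\<^sup>+\<rho>\<in>{1/r..}. inverse (ennreal \<rho> * (SUP x. T x \<rho>)) \<partial>lborel) = \<infinity>"
    by (simp add: ennreal_mult_eq_top_iff)
  then show ?tail using r by (intro exI[of _ "1/r"]) auto
next
  assume tail: ?tail
  have upper_SUP: "(SUP x. Q x \<xi>) \<le> ennreal (K * (norm \<xi>)\<^sup>2) * (1 + (SUP x. T x (1 / norm \<xi>)))" for \<xi>
  proof (rule SUP_least)
    fix x
    show "Q x \<xi> \<le> ennreal (K * (norm \<xi>)\<^sup>2) * (1 + (SUP x. T x (1 / norm \<xi>)))"
      by (rule order_trans[OF upper]) (intro mult_left_mono add_left_mono SUP_upper; simp)
  qed
  have "(\<integral>\<^sup>+\<xi>\<in>ball 0 1. inverse (SUP x. Q x \<xi>) \<partial>lborel) = \<infinity>"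
  proof (cases "(SUP x. T x 1) = 0")
    case True
    have "(SUP x. Q x \<xi>) \<le> ennreal (K * (norm \<xi>)\<^sup>2) * (\<lambda>_. 1) (1 / norm \<xi>)" for \<xi>
      using upper_SUP[of \<xi>] SUP_eq_0[OF zero_less_one True] by simp
    from nn_integral_ball_inverse_ge[OF _ K_pos zero_less_one this]
    have "ennreal (2 * pi / K) * (\<integral>\<^sup>+\<rho>\<in>{1..}. inverse (ennreal \<rho>) \<partial>lborel)
        \<le> (\<integral>\<^sup>+\<xi>\<in>ball (0::real^2) 1. inverse (SUP x. Q x \<xi>) \<partial>lborel)"
      by (simp add: mono_def)
    then show ?thesis
      using K_pos nn_integral_inverse_atLeast[of 1] by (simp add: ennreal_mult_top top_unique)
  next
    case False
    \<comment> \<open>A real lower bound is needed because the supremum may be infinite.\<close>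
    obtain a where a: "0 < a" "ennreal a \<le> (SUP x. T x 1)"
    proof (cases "SUP x. T x 1")
      case (real b)
      with False show ?thesis using that[of b] by auto
    next
      case top
      then show ?thesis using that[OF zero_less_one] by (simp only: top_greatest)
    qed
    have "(SUP x. Q x \<xi>) \<le> ennreal (K * (1/a + 1) * (norm \<xi>)\<^sup>2) * (SUP x. T x (1 / norm \<xi>))"
      if "norm \<xi> < 1" for \<xi>
    proof (cases "\<xi> = 0")
      case True
      then show ?thesis using upper_SUP[of 0] by simp
    next
      case nz: False
      let ?S = "SUP x. T x (1 / norm \<xi>)"
      have "ennreal a \<le> ?S"
        using a(2) monoD[OF mono_SUP, of 1 "1 / norm \<xi>"] that nz by (auto simp: field_simps)
      then have "ennreal (1/a) * ennreal a \<le> ennreal (1/a) * ?S" by (rule mult_left_mono) simp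
      moreover have "ennreal (1/a) * ennreal a = 1" using a(1) by (simp add: ennreal_mult'[symmetric])
      ultimately have "1 + ?S \<le> ennreal (1/a) * ?S + ?S" by (intro add_right_mono) simp
      also have "\<dots> = ennreal (1/a + 1) * ?S" using a(1) by (simp add: distrib_right)
      finally have "(SUP x. Q x \<xi>) \<le> ennreal (K * (norm \<xi>)\<^sup>2) * (ennreal (1/a + 1) * ?S)"
        using upper_SUP[of \<xi>] by (meson mult_left_mono order_trans zero_le)
      also have "\<dots> = ennreal (K * (1/a + 1) * (norm \<xi>)\<^sup>2) * ?S"
      proof -
        have "K * (1/a + 1) * (norm \<xi>)\<^sup>2 = K * (norm \<xi>)\<^sup>2 * (1/a + 1)" by simp
        moreover have "ennreal \<dots> = ennreal (K * (norm \<xi>)\<^sup>2) * ennreal (1/a + 1)"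
          using K_pos by (intro ennreal_mult') simp
        ultimately show ?thesis by (simp only: mult.assoc)
      qed
      finally show ?thesis .
    qed
    from nn_integral_ball_inverse_ge[OF mono_SUP _ zero_less_one this] K_pos a(1)
    have "ennreal (2 * pi / (K * (1/a + 1))) * (\<integral>\<^sup>+\<rho>\<in>{1..}. inverse (ennreal \<rho> * (SUP x. T x \<rho>)) \<partial>lborel)
        \<le> (\<integral>\<^sup>+\<xi>\<in>ball (0::real^2) 1. inverse (SUP x. Q x \<xi>) \<partial>lborel)"
      by (simp add: add_pos_pos)
    moreover have "(\<integral>\<^sup>+\<rho>\<in>{1..}. inverse (ennreal \<rho> * (SUP x. T x \<rho>)) \<partial>lborel) = \<infinity>"
      using tail tail_SUP_independent_of_start zero_less_one by blast
    moreover have "ennreal (2 * pi / (K * (1/a + 1))) \<noteq> 0"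
      using K_pos a(1) by (simp add: add_pos_pos less_imp_neq[THEN not_sym])
    ultimately show ?thesis by (simp add: ennreal_mult_top top_unique del: ennreal_eq_0_iff)
  qed
  then show ?ball by (intro exI[of _ 1]) simp
qed

text \<open>An infimum may be small although every \<open>T x\<close> is positive, so the bound \<open>1 \<le> T x \<rho>\<close> has to be
  uniform in \<open>x\<close>. It absorbs the summand 1 on the disc of radius \<open>1/\<rho>0\<close>, and a finite integral over
  a larger disc may be restricted to that one.\<close>

lemma INF_criterion:
  assumes \<rho>0: "0 < \<rho>0" and ge_1: "\<And>x \<rho>. \<rho>0 \<le> \<rho> \<Longrightarrow> 1 \<le> T x \<rho>"
  shows "(\<exists>r>0. (\<integral>\<^sup>+\<xi>\<in>ball 0 r. inverse (INF x. Q x \<xi>) \<partial>lborel) < \<infinity>) \<longleftrightarrow>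
    (\<exists>r>0. (\<integral>\<^sup>+\<rho>\<in>{r..}. inverse (ennreal \<rho> * (INF x. T x \<rho>)) \<partial>lborel) < \<infinity>)"
  (is "?ball \<longleftrightarrow> ?tail")
proof
  assume ?tail
  then obtain r where r: "0 < r" and fin: "(\<integral>\<^sup>+\<rho>\<in>{r..}. inverse (ennreal \<rho> * (INF x. T x \<rho>)) \<partial>lborel) < \<infinity>" by auto
  have "ennreal (k * (norm \<xi>)\<^sup>2) * (INF x. T x (1 / norm \<xi>)) \<le> (INF x. Q x \<xi>)" for \<xi>
  proof (rule INF_greatest)
    fix x
    show "ennreal (k * (norm \<xi>)\<^sup>2) * (INF x. T x (1 / norm \<xi>)) \<le> Q x \<xi>"
      by (rule order_trans[OF _ lower]) (intro mult_left_mono INF_lower; simp)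
  qed
  from nn_integral_ball_inverse_le[OF mono_INF k_pos _ this, of "1/r"] r
  have "(\<integral>\<^sup>+\<xi>\<in>ball (0::real^2) (1/r). inverse (INF x. Q x \<xi>) \<partial>lborel)
      \<le> ennreal (2 * pi / k) * (\<integral>\<^sup>+\<rho>\<in>{r..}. inverse (ennreal \<rho> * (INF x. T x \<rho>)) \<partial>lborel)"
    by simp
  also have "\<dots> < \<infinity>" using fin by (simp add: ennreal_mult_less_top)
  finally show ?ball using r by (intro exI[of _ "1/r"]) auto
next
  assume ?ball
  then obtain r where r: "0 < r" and fin: "(\<integral>\<^sup>+\<xi>\<in>ball 0 r. inverse (INF x. Q x \<xi>) \<partial>lborel) < \<infinity>" by auto
  define s where "s = min r (1 / \<rho>0)"
  have s: "0 < s" using r \<rho>0 by (simp add: s_def)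
  have "(INF x. Q x \<xi>) \<le> ennreal (K * 2 * (norm \<xi>)\<^sup>2) * (INF x. T x (1 / norm \<xi>))" if "norm \<xi> < s" for \<xi>
  proof (cases "\<xi> = 0")
    case True
    have "(INF x. Q x \<xi>) \<le> Q undefined \<xi>" by (rule INF_lower) simp
    also have "\<dots> = 0" using upper[of undefined \<xi>] True by simp
    finally show ?thesis by simp
  next
    case False
    let ?a = "K * 2 * (norm \<xi>)\<^sup>2"
    have a: "0 < ?a" using K_pos False by simp
    have inv: "ennreal (1 / b) * ennreal b = 1" "ennreal b * ennreal (1 / b) = 1" if "0 < b" for b :: real
      using that by (simp_all add: ennreal_mult'[symmetric])
    have \<rho>: "\<rho>0 \<le> 1 / norm \<xi>" using that False \<rho>0 by (auto simp: s_def field_simps)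
    have "ennreal (1 / ?a) * (INF x. Q x \<xi>) \<le> T x (1 / norm \<xi>)" for x
    proof -
      have "Q x \<xi> \<le> ennreal (K * (norm \<xi>)\<^sup>2) * (1 + T x (1 / norm \<xi>))" by (rule upper)
      also have "\<dots> \<le> ennreal (K * (norm \<xi>)\<^sup>2) * (T x (1 / norm \<xi>) + T x (1 / norm \<xi>))"
        by (intro mult_left_mono add_right_mono ge_1 \<rho>) simp
      also have "\<dots> = (ennreal (K * (norm \<xi>)\<^sup>2) * 2) * T x (1 / norm \<xi>)"
        by (simp only: mult_2[symmetric] mult.assoc)
      also have "ennreal (K * (norm \<xi>)\<^sup>2) * 2 = ennreal ?a"
        using ennreal_mult''[of 2 "K * (norm \<xi>)\<^sup>2"] by (simp add: ac_simps)
      finally have "(INF x. Q x \<xi>) \<le> ennreal ?a * T x (1 / norm \<xi>)"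
        by (rule INF_lower2[OF UNIV_I])
      then have "ennreal (1 / ?a) * (INF x. Q x \<xi>) \<le> ennreal (1 / ?a) * (ennreal ?a * T x (1 / norm \<xi>))"
        by (rule mult_left_mono) simp
      also have "\<dots> = T x (1 / norm \<xi>)"
        by (simp only: mult.assoc[symmetric] inv(1)[OF a] mult_1)
      finally show ?thesis .
    qed
    then have "ennreal ?a * (ennreal (1 / ?a) * (INF x. Q x \<xi>)) \<le> ennreal ?a * (INF x. T x (1 / norm \<xi>))"
      by (intro mult_left_mono INF_greatest) auto
    then show ?thesis by (simp only: mult.assoc[symmetric] inv(2)[OF a] mult_1)
  qed
  from nn_integral_ball_inverse_ge[OF mono_INF _ s this] K_pos
  have "ennreal (2 * pi / (K * 2)) * (\<integral>\<^sup>+\<rho>\<in>{1/s..}. inverse (ennreal \<rho> * (INF x. T x \<rho>)) \<partial>lborel)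
      \<le> (\<integral>\<^sup>+\<xi>\<in>ball (0::real^2) s. inverse (INF x. Q x \<xi>) \<partial>lborel)"
    by simp
  also have "\<dots> \<le> (\<integral>\<^sup>+\<xi>\<in>ball 0 r. inverse (INF x. Q x \<xi>) \<partial>lborel)"
    by (intro nn_integral_mono) (auto simp: indicator_def s_def)
  also have "\<dots> < \<infinity>" by (rule fin)
  finally have "(\<integral>\<^sup>+\<rho>\<in>{1/s..}. inverse (ennreal \<rho> * (INF x. T x \<rho>)) \<partial>lborel) < \<infinity>"
    using K_pos by (auto simp: ennreal_mult_less_top)
  then show ?tail using s by (intro exI[of _ "1/s"]) auto
qed

end

section \<open>Radial symbols in the plane\<close>

lemma radial_in_covariable_norm_eq:
  assumes "radial_in_covariable q" "norm \<xi> = norm \<eta>"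
  shows "q x \<xi> = q x \<eta>"
proof -
  obtain f :: "real^2 \<Rightarrow> real^2" where f: "orthogonal_transformation f" "det (matrix f) = 1" "f \<eta> = \<xi>"
    using rotation_exists[of \<eta> \<xi>] assms(2) by auto
  then have "rotation_matrix (matrix f)" "matrix f *v \<eta> = \<xi>"
    by (auto simp: rotation_matrix_def orthogonal_transformation_matrix orthogonal_transformation_linear matrix_vector_mul)
  then show ?thesis using assms(1) unfolding radial_in_covariable_def by metis
qed

text \<open>The imaginary part of a Levy-Khintchine integral is odd, while a radial symbol is even: reality of
  the symbol follows from the rotation that takes \<open>\<xi>\<close> to \<open>- \<xi>\<close>. The jump exponent inherits
  radiality because the Gaussian part is radial itself.\<close>

lemma radial_symbol_decomposition:
  assumes radial: "radial_in_covariable q"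
    and c: "\<And>x. 0 \<le> c x"
    and triplet: "levy_triplet q (\<lambda>x. 0) (\<lambda>x. c x *\<^sub>R mat 1) \<nu>"
  shows "levy_measure (\<nu> x)"
    and "0 \<le> Re (q x \<xi>)" and "cmod (q x \<xi>) = Re (q x \<xi>)"
    and "c x / 2 * (norm \<xi>)\<^sup>2 \<le> Re (q x \<xi>)"
    and "ennreal (Re (q x \<xi>)) = ennreal (c x / 2 * (norm \<xi>)\<^sup>2) + jump_exponent (\<nu> x) \<xi>"
    and "norm \<eta> = norm \<xi> \<Longrightarrow> jump_exponent (\<nu> x) \<eta> = jump_exponent (\<nu> x) \<xi>"
proof -
  show N: "levy_measure (\<nu> x)"
    using triplet by (auto simp: levy_triplet_def levy_measure_def)
  interpret levy_measure "\<nu> x" by fact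
  have q: "q x \<xi> = of_real (c x / 2 * (norm \<xi>)\<^sup>2) + levy_khintchine \<xi>" for \<xi>
  proof -
    have "1/2 * (\<xi> \<bullet> ((c x *\<^sub>R mat 1) *v \<xi>)) = c x / 2 * (norm \<xi>)\<^sup>2"
      by (simp add: scaleR_matrix_vector_assoc[symmetric] power2_norm_eq_inner)
    then show ?thesis
      using triplet unfolding levy_triplet_def levy_khintchine_def by (simp only:) simp
  qed
  have Re: "Re (q x \<xi>) = c x / 2 * (norm \<xi>)\<^sup>2 + Re (levy_khintchine \<xi>)" for \<xi>
    by (simp add: q)
  show ge: "c x / 2 * (norm \<xi>)\<^sup>2 \<le> Re (q x \<xi>)"
    using Re_levy_khintchine(1)[of \<xi>] by (simp add: Re)
  have "0 \<le> c x / 2 * (norm \<xi>)\<^sup>2" using c[of x] by simp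
  with ge show nonneg: "0 \<le> Re (q x \<xi>)" by linarith
  have "Im (q x (- \<xi>)) = - Im (q x \<xi>)"
    by (simp add: q Im_levy_khintchine_minus)
  moreover have "q x (- \<xi>) = q x \<xi>"
    by (rule radial_in_covariable_norm_eq[OF radial]) simp
  ultimately have "Im (q x \<xi>) = 0" by simp
  then show "cmod (q x \<xi>) = Re (q x \<xi>)" using nonneg by (simp add: cmod_eq_Re)
  show "ennreal (Re (q x \<xi>)) = ennreal (c x / 2 * (norm \<xi>)\<^sup>2) + jump_exponent (\<nu> x) \<xi>"
    using c[of x] Re_levy_khintchine[of \<xi>] unfolding Re by (subst ennreal_plus) auto
  show "jump_exponent (\<nu> x) \<eta> = jump_exponent (\<nu> x) \<xi>" if "norm \<eta> = norm \<xi>"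
  proof -
    have "Re (q x \<eta>) = Re (q x \<xi>)" using radial_in_covariable_norm_eq[OF radial that] by simp
    then have "Re (levy_khintchine \<eta>) = Re (levy_khintchine \<xi>)" using that by (simp add: Re)
    then show ?thesis by (metis Re_levy_khintchine(2))
  qed
qed

text \<open>By the upper estimate \<open>J \<xi> / \<bar>\<xi>\<bar>\<^sup>2 \<le> 4 T (1/\<bar>\<xi>\<bar>)\<close>, it is enough that the limit inferior exceeds 4.\<close>

lemma eventually_tail_integral_ge_1:
  fixes \<nu> :: "'i \<Rightarrow> (real^2) measure"
  assumes N: "\<And>x. levy_measure (\<nu> x)"
    and lim: "Liminf (at 0) (\<lambda>\<xi>. INF x. \<integral>\<^sup>+y. ennreal ((1 - cos (\<xi> \<bullet> y)) / (norm \<xi>)\<^sup>2) \<partial>\<nu> x) = \<infinity>"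
  obtains \<rho>0 where "0 < \<rho>0" "\<And>x \<rho>. \<rho>0 \<le> \<rho> \<Longrightarrow> 1 \<le> tail_integral (\<nu> x) \<rho>"
proof -
  have "\<forall>\<^sub>F \<xi> in at 0. 4 < (INF x. \<integral>\<^sup>+y. ennreal ((1 - cos (\<xi> \<bullet> y)) / (norm \<xi>)\<^sup>2) \<partial>\<nu> x)"
    using iffD1[OF le_Liminf_iff eq_refl[OF lim[symmetric]], THEN spec, of 4] by (simp add: less_top[symmetric])
  then obtain d where d: "0 < d"
    and gt: "\<And>\<xi>. \<xi> \<noteq> 0 \<Longrightarrow> norm \<xi> < d \<Longrightarrow>
      4 < (INF x. \<integral>\<^sup>+y. ennreal ((1 - cos (\<xi> \<bullet> y)) / (norm \<xi>)\<^sup>2) \<partial>\<nu> x)"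
    unfolding eventually_at by auto
  show thesis
  proof
    show "0 < 2 / d" using d by simp
    fix x \<rho> assume \<rho>: "2 / d \<le> \<rho>"
    have pos: "0 < \<rho>" using d by (intro less_le_trans[OF _ \<rho>]) simp
    define \<xi> :: "real^2" where "\<xi> = (1 / \<rho>) *\<^sub>R axis 1 1"
    have norm: "norm \<xi> = 1 / \<rho>" using pos by (simp add: \<xi>_def)
    have nz: "\<xi> \<noteq> 0" using norm pos by auto
    have "norm \<xi> < d" using \<rho> d pos by (simp add: norm field_simps)
    interpret levy_measure "\<nu> x" by (rule N)
    have "4 < (\<integral>\<^sup>+y. ennreal ((1 - cos (\<xi> \<bullet> y)) / (norm \<xi>)\<^sup>2) \<partial>\<nu> x)"
      using gt[OF nz \<open>norm \<xi> < d\<close>] by (auto dest: less_INF_D)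
    also have "\<dots> = (\<integral>\<^sup>+y. ennreal (1 / (norm \<xi>)\<^sup>2) * ennreal (1 - cos (\<xi> \<bullet> y)) \<partial>\<nu> x)"
      by (intro nn_integral_cong) (simp add: ennreal_mult'[symmetric])
    also have "\<dots> = ennreal (1 / (norm \<xi>)\<^sup>2) * jump_exponent (\<nu> x) \<xi>"
      unfolding jump_exponent_def by (rule nn_integral_cmult) measurable
    also have "\<dots> \<le> ennreal (1 / (norm \<xi>)\<^sup>2) * (ennreal (4 * (norm \<xi>)\<^sup>2) * tail_integral (\<nu> x) (1 / norm \<xi>))"
      by (intro mult_left_mono jump_exponent_le_tail_integral[OF N nz]) simp
    also have "\<dots> = 4 * tail_integral (\<nu> x) \<rho>"
    proof -
      have "ennreal (1 / (norm \<xi>)\<^sup>2) * ennreal (4 * (norm \<xi>)\<^sup>2) = 4"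
        using nz by (simp add: ennreal_mult'[symmetric])
      moreover have "1 / norm \<xi> = \<rho>" using norm pos by simp
      ultimately show ?thesis by (simp only: mult.assoc[symmetric])
    qed
    finally have "4 * 1 \<le> 4 * tail_integral (\<nu> x) \<rho>" by simp
    then show "1 \<le> tail_integral (\<nu> x) \<rho>"
      by (subst (asm) ennreal_mult_le_mult_iff) auto
  qed
qed

theorem theorem4p4:
  fixes M :: "'w measure" and P :: "real^2 \<Rightarrow> 'w measure" and F :: "real \<Rightarrow> 'w \<Rightarrow> real^2"
    and q :: "real^2 \<Rightarrow> real^2 \<Rightarrow> complex" and c :: "real^2 \<Rightarrow> real"
    and \<nu> :: "real^2 \<Rightarrow> (real^2) measure" and u0 :: real
  assumes "levy_type_process M P F q"
    and "open_set_irreducible M P F"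
    and "radial_in_covariable q"
    and "c \<in> borel_measurable borel" and "\<forall>x. 0 \<le> c x"
    and "levy_triplet q (\<lambda>x. 0) (\<lambda>x. c x *\<^sub>R mat 1) \<nu>"
    and "u0 > 1"
    and "\<forall>x. quasi_unimodal (distr (\<nu> x) borel (\<lambda>y. y $ 1)) u0"
  shows "((\<exists>r>0. (\<integral>\<^sup>+\<xi>\<in>ball 0 r. inverse (SUP x. ennreal (cmod (q x \<xi>))) \<partial>lborel) = \<infinity>) \<longleftrightarrow>
          (\<exists>r>0. (\<integral>\<^sup>+\<rho>\<in>{r..}. inverse (ennreal \<rho> * (SUP x. tail_integral (\<nu> x) \<rho>)) \<partial>lborel) = \<infinity>))
       \<and> ((\<exists>r>0. (\<integral>\<^sup>+\<rho>\<in>{r..}. inverse (ennreal \<rho> * (SUP x. tail_integral (\<nu> x) \<rho>)) \<partial>lborel) = \<infinity>) \<longleftrightarrow>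
          (\<forall>r>0. (\<integral>\<^sup>+\<rho>\<in>{r..}. inverse (ennreal \<rho> * (SUP x. tail_integral (\<nu> x) \<rho>)) \<partial>lborel) = \<infinity>))
       \<and> (Liminf (at 0) (\<lambda>\<xi>. INF x. \<integral>\<^sup>+y. ennreal ((1 - cos (\<xi> \<bullet> y)) / (norm \<xi>)\<^sup>2) \<partial>\<nu> x) = \<infinity> \<longrightarrow>
          ((\<exists>r>0. (\<integral>\<^sup>+\<xi>\<in>ball 0 r. inverse (INF x. ennreal (Re (q x \<xi>))) \<partial>lborel) < \<infinity>) \<longleftrightarrow>
           (\<exists>r>0. (\<integral>\<^sup>+\<rho>\<in>{r..}. inverse (ennreal \<rho> * (INF x. tail_integral (\<nu> x) \<rho>)) \<partial>lborel) < \<infinity>)))"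
proof -
  have c: "0 \<le> c x" for x using assms(5) by blast
  note dec = radial_symbol_decomposition[OF assms(3) c assms(6)]
  obtain K where K: "0 < K" "\<And>\<xi> x. cmod (q x \<xi>) \<le> K * (1 + (norm \<xi>)\<^sup>2)"
    using assms(1) unfolding levy_type_process_def by blast
  \<comment> \<open>The growth condition is evaluated at a unit vector.\<close>
  have c_le: "c x / 2 \<le> 2 * K" for x
    using dec(4)[of x "axis 1 1"] K(2)[of x "axis 1 1"] dec(3)[of x "axis 1 1"] by simp
  interpret comparable_family "\<lambda>x \<xi>. ennreal (Re (q x \<xi>))" "\<lambda>x. tail_integral (\<nu> x)" "1/30" "2 * K + 4"
  proof
    show "mono (tail_integral (\<nu> x))" for x by (rule mono_tail_integral)
    show "tail_integral (\<nu> x) \<rho>' = 0" if "0 < \<rho>" "tail_integral (\<nu> x) \<rho> = 0" for x \<rho> \<rho>'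
      using that by (rule tail_integral_eq_0[OF dec(1)])
    show "ennreal (1/30 * (norm \<xi>)\<^sup>2) * tail_integral (\<nu> x) (1 / norm \<xi>) \<le> ennreal (Re (q x \<xi>))" for x \<xi>
    proof (cases "\<xi> = 0")
      case False
      have "ennreal (1/30 * (norm \<xi>)\<^sup>2) * tail_integral (\<nu> x) (1 / norm \<xi>) \<le> jump_exponent (\<nu> x) \<xi>"
        by (rule tail_integral_le_radial_jump_exponent[OF dec(1) False dec(6)])
      also have "\<dots> \<le> ennreal (Re (q x \<xi>))"
        unfolding dec(5) by (simp add: add_increasing)
      finally show ?thesis .
    qed simp
    show "ennreal (Re (q x \<xi>)) \<le> ennreal ((2 * K + 4) * (norm \<xi>)\<^sup>2) * (1 + tail_integral (\<nu> x) (1 / norm \<xi>))" for x \<xi>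
    proof (cases "\<xi> = 0")
      case True
      have "q x 0 = 0" using assms(1) unfolding levy_type_process_def by blast
      then show ?thesis using True by simp
    next
      case False
      let ?b = "ennreal ((2 * K + 4) * (norm \<xi>)\<^sup>2)"
      have "ennreal (c x / 2 * (norm \<xi>)\<^sup>2) \<le> ?b"
        using c_le[of x] K(1) by (intro ennreal_leI mult_right_mono) auto
      moreover have "jump_exponent (\<nu> x) \<xi> \<le> ?b * tail_integral (\<nu> x) (1 / norm \<xi>)"
      proof (rule order_trans[OF jump_exponent_le_tail_integral[OF dec(1) False]])
        show "ennreal (4 * (norm \<xi>)\<^sup>2) * tail_integral (\<nu> x) (1 / norm \<xi>)
            \<le> ?b * tail_integral (\<nu> x) (1 / norm \<xi>)"
          using K(1) by (intro mult_right_mono ennreal_leI) auto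
      qed
      ultimately show ?thesis
        unfolding dec(5) distrib_left mult_1_right by (rule add_mono)
    qed
  qed (use K(1) in auto)
  show ?thesis
    unfolding dec(3)
  proof (intro conjI impI)
    assume "Liminf (at 0) (\<lambda>\<xi>. INF x. \<integral>\<^sup>+y. ennreal ((1 - cos (\<xi> \<bullet> y)) / (norm \<xi>)\<^sup>2) \<partial>\<nu> x) = \<infinity>"
    from eventually_tail_integral_ge_1[OF dec(1) this]
    obtain \<rho>0 where "0 < \<rho>0" "\<And>x \<rho>. \<rho>0 \<le> \<rho> \<Longrightarrow> 1 \<le> tail_integral (\<nu> x) \<rho>" by blast
    then show "(\<exists>r>0. (\<integral>\<^sup>+\<xi>\<in>ball 0 r. inverse (INF x. ennreal (Re (q x \<xi>))) \<partial>lborel) < \<infinity>) \<longleftrightarrow>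
        (\<exists>r>0. (\<integral>\<^sup>+\<rho>\<in>{r..}. inverse (ennreal \<rho> * (INF x. tail_integral (\<nu> x) \<rho>)) \<partial>lborel) < \<infinity>)"
      by (rule INF_criterion)
  qed (rule SUP_criterion tail_SUP_independent_of_start)+
qed

end
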